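(* Let $(\psi,\mathcal X,\mathcal Y,\mathcal U,\mathcal P,\|\cdot\|,r)$ be a dual-extraction setup (defined in the context), let $y_0\in\mathcal Y\cap\operatorname{int}\mathcal P$, and let $y^\star\in\operatorname{argmax}_{y\in\mathcal Y}\phi(y)$. Let $B>0$ be such that $V_{y_0}(y^\star)\le B$. Then for any $\epsilon>0$ and $K\in\mathbb N$, the output $y_K$ of the dual-extraction framework (defined in the context) started at $y_0$ with $$\lambda_k=2^k\frac{\epsilon}{4B}\ \text{ for }k\in\{0,1,\dots,K-1\}\qquad\text{and}\qquad\epsilon_k=\frac{\epsilon}{8\cdot1.5^k}\ \text{ for }k\in\{1,\dots,K\}$$ satisfies $$\mathbb E\,\|y_K-u\|\le\frac1{1.5^K}\sqrt{\frac{2B}{\mu_r}},$$ where $u\in\mathcal Y$ is a (random) point whose expected suboptimality is at most $\epsilon$, i.e. $\phi(y^\star)-\mathbb E\,\phi(u)\le\epsilon$.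
   Context: Dgf setup. $(\mathcal U,\mathcal P,\|\cdot\|,r)$ is a dgf setup over $\mathbb R^n$ if $\mathcal U\subseteq\mathcal P\subseteq\mathbb R^n$ are closed convex sets with $\mathcal U\cap\operatorname{int}\mathcal P\ne\emptyset$, $\|\cdot\|$ is a norm on $\mathbb R^n$, and: (i) $r:\mathcal P\to\mathbb R$ is convex and continuous on $\mathcal P$, differentiable on $\operatorname{int}\mathcal P$, and $\mu_r$-strongly convex with respect to $\|\cdot\|$ on $\mathcal U\cap\operatorname{int}\mathcal P$ for some $\mu_r>0$; (ii) either $\lim_{u\to\operatorname{bd}\mathcal P}\|\nabla r(u)\|_2=\infty$ or $\mathcal U\subseteq\operatorname{int}\mathcal P$. Its Bregman divergence is $V_u(v):=r(v)-r(u)-\langle\nabla r(u),v-u\rangle$ for $u\in\operatorname{int}\mathcal P$, $v\in\mathcal P$. Dual-extraction setup. A tuple $(\psi,\mathcal X,\mathcal Y,\mathcal U,\mathcal P,\|\cdot\|,r)$ with $\psi:\mathbb R^d\times\mathbb R^n\to\mathbb R$ such that: (i) $\psi(x,\cdot)$ is differentiable for every $x$; (ii) $\psi(\cdot,y)$ is convex for every $y$ and $\psi(x,\cdot)$ is concave for every $x$; (iii) $(\mathcal U,\mathcal P,\|\cdot\|,r)$ is a dgf setup over $\mathbb R^n$; (iv) $\mathcal X\subseteq\mathbb R^d$ and $\mathcal Y\subseteq\mathbb R^n$ are nonempty, closed, convex, with $\mathcal Y\subseteq\mathcal U$ and $\mathcal Y\cap\operatorname{int}\mathcal P\neq\emptyset$;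 (v) $\mathcal X$ is bounded or $\psi(\cdot,y)$ is strongly convex for every $y$; (vi) $\mathcal Y$ is bounded or $\psi(x,\cdot)$ is strongly concave for every $x$; (vii) for all $p\in\mathcal U\cap\operatorname{int}\mathcal P$ and all $w\in\partial\mathbb I_{\mathcal U}(p)$ (with $\mathbb I_{\mathcal U}$ the $0/\infty$ indicator of $\mathcal U$), the map $y\mapsto\langle w,y\rangle$ is constant over $\mathcal Y$. Notation. $\phi(y):=\min_{x\in\mathcal X}\psi(x,y)$ on $\mathcal Y$; for $\lambda>0$ and $q\in\mathcal U\cap\operatorname{int}\mathcal P$, $f_{\lambda,q}(x):=\max_{y\in\mathcal Y}\{\psi(x,y)-\lambda V_q(y)\}$ on $\mathcal X$. Oracles. $\mathrm{DRPO}(q,\lambda,\epsilon_{\mathrm p})$ returns a (possibly random) $x\in\mathcal X$ with $\mathbb E f_{\lambda,q}(x)\le\inf_{x'\in\mathcal X}f_{\lambda,q}(x')+\epsilon_{\mathrm p}$, the expectation being over the oracle's internal randomness. $\mathrm{DRBR}(q,\lambda,x)$ returns $\operatorname{argmax}_{y\in\mathcal Y}\{\psi(x,y)-\lambda V_q(y)\}$. Dual-extraction framework. Inputs: $y_0$, $K$, $(\lambda_k)_{k=0}^{K-1}$, $(\epsilon_k)_{k=1}^K$. For $k=1,\dots,K$: set $\Lambda_k=\sum_{j=0}^{k-1}\lambda_j$; $q_k=\operatorname{argmin}_{q\in\mathcal U}\frac1{\Lambda_k}\sum_{j=0}^{k-1}\lambda_jV_{y_j}(q)$; $x_k=\mathrm{DRPO}(q_k,\Lambda_k,\epsilon_k)$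 (the oracle guarantee holds conditionally on the previously generated iterates); $y_k=\mathrm{DRBR}(q_k,\Lambda_k,x_k)$. Return $y_K$. Expectations are over the randomness of all DRPO calls. *)

theory Defs
  imports "HOL-Probability.Probability"
begin

text \<open>An arbitrary norm on a vector space; the type-class norm is reserved for the Euclidean norm.\<close>

definition is_norm :: "('b::real_vector \<Rightarrow> real) \<Rightarrow> bool" where
  "is_norm N \<longleftrightarrow>
     (\<forall>x. 0 \<le> N x) \<and> (\<forall>x. N x = 0 \<longleftrightarrow> x = 0) \<and>
     (\<forall>a x. N (a *\<^sub>R x) = \<bar>a\<bar> * N x) \<and> (\<forall>x y. N (x + y) \<le> N x + N y)"

definition strongly_convex_on ::
  "('b::real_vector \<Rightarrow> real) \<Rightarrow> 'b set \<Rightarrow> real \<Rightarrow> ('b \<Rightarrow> real) \<Rightarrow> bool" where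
  "strongly_convex_on N S \<mu> f \<longleftrightarrow>
     (\<forall>x\<in>S. \<forall>y\<in>S. \<forall>t\<in>{0..1}.
        f ((1 - t) *\<^sub>R x + t *\<^sub>R y)
          \<le> (1 - t) * f x + t * f y - \<mu> / 2 * t * (1 - t) * (N (x - y))\<^sup>2)"

definition gradient :: "('b::euclidean_space \<Rightarrow> real) \<Rightarrow> 'b \<Rightarrow> 'b" where
  "gradient f u = (THE g. GDERIV f u :> g)"

definition bregman :: "('b::euclidean_space \<Rightarrow> real) \<Rightarrow> 'b \<Rightarrow> 'b \<Rightarrow> real" where
  "bregman r u v = r v - r u - gradient r u \<bullet> (v - u)"

definition set_indicator :: "'b set \<Rightarrow> 'b \<Rightarrow> ereal" where
  "set_indicator U v = (if v \<in> U then 0 else \<infinity>)"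

text \<open>Only meant for points at which the function is finite.\<close>

definition subdifferential :: "('b::real_inner \<Rightarrow> ereal) \<Rightarrow> 'b \<Rightarrow> 'b set" where
  "subdifferential f p = {w. \<forall>v. f p + ereal (w \<bullet> (v - p)) \<le> f v}"

locale dgf_setup =
  fixes U P :: "'b::euclidean_space set"
    and N :: "'b \<Rightarrow> real"
    and r :: "'b \<Rightarrow> real"
    and \<mu> :: real
  assumes U_sub_P: "U \<subseteq> P"
    and closed_U: "closed U" and convex_U: "convex U"
    and closed_P: "closed P" and convex_P: "convex P"
    and U_int_P: "U \<inter> interior P \<noteq> {}"
    and norm_N: "is_norm N"
    and convex_r: "convex_on P r"
    and continuous_r: "continuous_on P r"
    and differentiable_r: "\<And>u. u \<in> interior P \<Longrightarrow> r differentiable (at u)"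
    and \<mu>_pos: "0 < \<mu>"
    and strongly_convex_r: "strongly_convex_on N (U \<inter> interior P) \<mu> r"
    and barrier:
      "(\<forall>b\<in>frontier P. filterlim (\<lambda>u. norm (gradient r u)) at_top (at b within interior P))
       \<or> U \<subseteq> interior P"

locale dual_extraction_setup = dgf_setup U P N r \<mu>
  for \<psi> :: "'a::euclidean_space \<Rightarrow> 'b::euclidean_space \<Rightarrow> real"
    and X :: "'a set" and Y :: "'b set" and U P :: "'b set"
    and N :: "'b \<Rightarrow> real" and r :: "'b \<Rightarrow> real" and \<mu> :: real +
  assumes differentiable_psi: "\<And>x y. \<psi> x differentiable (at y)"
    and convex_psi: "\<And>y. convex_on UNIV (\<lambda>x. \<psi> x y)"
    and concave_psi: "\<And>x. concave_on UNIV (\<psi> x)"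
    and X_set: "X \<noteq> {}" "closed X" "convex X"
    and Y_set: "Y \<noteq> {}" "closed Y" "convex Y"
    and Y_sub_U: "Y \<subseteq> U"
    and Y_int_P: "Y \<inter> interior P \<noteq> {}"
    and X_bounded_or:
      "bounded X \<or> (\<forall>y. \<exists>m>0. strongly_convex_on norm UNIV m (\<lambda>x. \<psi> x y))"
    and Y_bounded_or:
      "bounded Y \<or> (\<forall>x. \<exists>m>0. strongly_convex_on norm UNIV m (\<lambda>y. - \<psi> x y))"
    and normal_const:
      "\<And>p w. p \<in> U \<inter> interior P \<Longrightarrow> w \<in> subdifferential (set_indicator U) p \<Longrightarrow>
         \<exists>c. \<forall>y\<in>Y. w \<bullet> y = c"

text \<open>The dual function and the regularized primal function. In a dual-extraction setup the
  infimum (for \<open>y \<in> Y\<close>) and the supremum (for \<open>l > 0\<close> and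
  \<open>q \<in> U \<inter> interior P\<close>) are attained, hence are the minimum and the maximum.\<close>

definition dual_fun :: "('a \<Rightarrow> 'b \<Rightarrow> real) \<Rightarrow> 'a set \<Rightarrow> 'b \<Rightarrow> real" where
  "dual_fun \<psi> X y = (INF x\<in>X. \<psi> x y)"

definition reg_primal ::
  "('a \<Rightarrow> 'b::euclidean_space \<Rightarrow> real) \<Rightarrow> 'b set \<Rightarrow> ('b \<Rightarrow> real) \<Rightarrow> real \<Rightarrow> 'b \<Rightarrow> 'a \<Rightarrow> real" where
  "reg_primal \<psi> Y r l q x = (SUP y\<in>Y. \<psi> x y - l * bregman r q y)"

text \<open>\<open>past_iterates M q x y k\<close> is the sigma-algebra generated by everything known when the
  \<open>k\<close>-th primal oracle call is made.\<close>

definition past_iterates ::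
  "'w measure \<Rightarrow> (nat \<Rightarrow> 'w \<Rightarrow> 'b::topological_space) \<Rightarrow> (nat \<Rightarrow> 'w \<Rightarrow> 'a::topological_space)
    \<Rightarrow> (nat \<Rightarrow> 'w \<Rightarrow> 'b) \<Rightarrow> nat \<Rightarrow> 'w measure" where
  "past_iterates M q x y k = sigma (space M)
     ({q j -` A \<inter> space M |j A. 1 \<le> j \<and> j \<le> k \<and> A \<in> sets borel} \<union>
      {x j -` A \<inter> space M |j A. 1 \<le> j \<and> j < k \<and> A \<in> sets borel} \<union>
      {y j -` A \<inter> space M |j A. j < k \<and> A \<in> sets borel})"

text \<open>\<open>x\<close> is a random answer of the primal oracle to the (random) query \<open>(q, l, e)\<close>: conditionally
  on \<open>F\<close>, which describes the past and makes \<open>q\<close> measurable, the expectation of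
  \<open>reg_primal \<psi> Y r l q x\<close> exceeds the infimum over \<open>X\<close> by at most \<open>e\<close>. The bound is stated for the
  nonnegative suboptimality gap, so that the conditional expectation makes sense
  although the infimum, as a function of the random \<open>q\<close>, need not be integrable.
  Measurability of the gap is required since \<open>nn_cond_exp\<close> is \<open>0\<close> on nonmeasurable functions.\<close>

definition drpo_gap ::
  "('a \<Rightarrow> 'b::euclidean_space \<Rightarrow> real) \<Rightarrow> 'a set \<Rightarrow> 'b set \<Rightarrow> ('b \<Rightarrow> real) \<Rightarrow> real \<Rightarrow> 'b \<Rightarrow> 'a \<Rightarrow> real" where
  "drpo_gap \<psi> X Y r l q x = reg_primal \<psi> Y r l q x - (INF x'\<in>X. reg_primal \<psi> Y r l q x')"

definition drpo_output ::
  "'w measure \<Rightarrow> 'w measure \<Rightarrow> ('a \<Rightarrow> 'b::euclidean_space \<Rightarrow> real) \<Rightarrow> 'a set \<Rightarrow> 'b set \<Rightarrow> ('b \<Rightarrow> real)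
    \<Rightarrow> ('w \<Rightarrow> 'b) \<Rightarrow> real \<Rightarrow> real \<Rightarrow> ('w \<Rightarrow> 'a) \<Rightarrow> bool" where
  "drpo_output M F \<psi> X Y r q l e x \<longleftrightarrow>
     (\<forall>\<omega>\<in>space M. x \<omega> \<in> X) \<and>
     (\<lambda>\<omega>. drpo_gap \<psi> X Y r l (q \<omega>) (x \<omega>)) \<in> borel_measurable M \<and>
     (AE \<omega> in M. nn_cond_exp M F (\<lambda>\<omega>. ennreal (drpo_gap \<psi> X Y r l (q \<omega>) (x \<omega>))) \<omega> \<le> ennreal e)"

definition drbr_output ::
  "('a \<Rightarrow> 'b::euclidean_space \<Rightarrow> real) \<Rightarrow> 'b set \<Rightarrow> ('b \<Rightarrow> real) \<Rightarrow> 'b \<Rightarrow> real \<Rightarrow> 'a \<Rightarrow> 'b \<Rightarrow> bool" where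
  "drbr_output \<psi> Y r q l x y \<longleftrightarrow> is_arg_max (\<lambda>v. \<psi> x v - l * bregman r q v) (\<lambda>v. v \<in> Y) y"

text \<open>A run of the framework: random variables \<open>q k\<close>, \<open>x k\<close>, \<open>y k\<close> on a probability space carrying
  the randomness of all primal oracle calls.\<close>

locale dual_extraction_run = prob_space M
  for M :: "'w measure"
    and \<psi> :: "'a::euclidean_space \<Rightarrow> 'b::euclidean_space \<Rightarrow> real"
    and X :: "'a set" and Y U :: "'b set" and r :: "'b \<Rightarrow> real"
    and y0 :: 'b and K :: nat and lam eps :: "nat \<Rightarrow> real"
    and q :: "nat \<Rightarrow> 'w \<Rightarrow> 'b" and x :: "nat \<Rightarrow> 'w \<Rightarrow> 'a" and y :: "nat \<Rightarrow> 'w \<Rightarrow> 'b" +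
  assumes measurable_iterates: "\<And>k. k \<in> {1..K} \<Longrightarrow>
        q k \<in> borel_measurable M \<and> x k \<in> borel_measurable M \<and> y k \<in> borel_measurable M"
    and y_init: "\<And>\<omega>. \<omega> \<in> space M \<Longrightarrow> y 0 \<omega> = y0"
    and q_step: "\<And>k \<omega>. k \<in> {1..K} \<Longrightarrow> \<omega> \<in> space M \<Longrightarrow>
        is_arg_min (\<lambda>p. 1 / (\<Sum>j<k. lam j) * (\<Sum>j<k. lam j * bregman r (y j \<omega>) p))
          (\<lambda>p. p \<in> U) (q k \<omega>)"
    and x_step: "\<And>k. k \<in> {1..K} \<Longrightarrow>
        drpo_output M (past_iterates M q x y k) \<psi> X Y r (q k) (\<Sum>j<k. lam j) (eps k) (x k)"
    and y_step: "\<And>k \<omega>. k \<in> {1..K} \<Longrightarrow> \<omega> \<in> space M \<Longrightarrow>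
        drbr_output \<psi> Y r (q k \<omega>) (\<Sum>j<k. lam j) (x k \<omega>) (y k \<omega>)"

end

theory Submission
  imports Defs
begin

text \<open>
  Write \<open>\<phi>\<close> for the dual function, \<open>V\<close> for the Bregman divergence, \<open>\<Lambda>\<^sub>k = \<Sum>j<k. \<lambda>\<^sub>j\<close>, and let
  \<open>y\<^sup>*\<^sub>k\<close> be the maximizer over \<open>Y\<close> of \<open>\<phi> - (\<Sum>j<k. \<lambda>\<^sub>j V\<^bsub>y\<^sub>j\<^esub>)\<close>. The witness is \<open>u = y\<^sup>*\<^sub>K\<close>
  (and \<open>u = y\<^sup>*\<close>, the given maximizer of \<open>\<phi>\<close>, when \<open>K = 0\<close>). Three facts make it work.

  First, the point \<open>q\<^sub>k\<close> summarizes all the regularizers: on \<open>Y\<close> the sum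
  \<open>\<Sum>j<k. \<lambda>\<^sub>j V\<^bsub>y\<^sub>j\<^esub>\<close> equals \<open>\<Lambda>\<^sub>k V\<^bsub>q\<^sub>k\<^esub>\<close> up to a constant, because the optimality condition of \<open>q\<^sub>k\<close> says
  that the two differ by the linear form of a normal vector of \<open>U\<close>, and such forms are constant on
  \<open>Y\<close> (\<open>mirror_step\<close>). So \<open>y\<^sup>*\<^sub>k\<close> maximizes \<open>\<phi> - \<Lambda>\<^sub>k V\<^bsub>q\<^sub>k\<^esub>\<close>.

  Second, primal suboptimality controls the distance to this dual maximizer. The best response
  \<open>y\<^sub>k\<close> to \<open>x\<^sub>k\<close> satisfies a three-point inequality, and the minimum of the regularized primal
  function is at most the maximum of the regularized dual function (\<open>minimax_at_minimizer\<close>, which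
  rests on strong concavity in \<open>y\<close>). Together,
  \<open>\<Lambda>\<^sub>k V\<^bsub>y\<^sub>k\<^esub>(y\<^sup>*\<^sub>k)\<close> is at most the suboptimality of \<open>x\<^sub>k\<close>
  (\<open>bregman_dual_maximizer_le_gap\<close>), whose expectation is at most \<open>\<epsilon>\<^sub>k\<close>. Strong convexity of
  \<open>r\<close> turns this into the bound on the expected norm of \<open>y\<^sub>K - y\<^sup>*\<^sub>K\<close>. For these inequalities
  \<open>q\<^sub>k\<close> and \<open>y\<^sub>k\<close> have to lie in the interior of \<open>P\<close>, where \<open>r\<close> has a gradient; this is what the
  barrier condition is for (\<open>minimizer_in_interior\<close>).

  Third, comparing \<open>y\<^sup>*\<^bsub>k+1\<^esub>\<close> with \<open>y\<^sup>*\<^sub>k\<close> in the objective that defines the former loses only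
  \<open>\<lambda>\<^sub>k V\<^bsub>y\<^sub>k\<^esub>(y\<^sup>*\<^sub>k)\<close>. Telescoping gives that \<open>\<phi>(y\<^sup>*) - \<phi>(y\<^sup>*\<^sub>K)\<close> is at most
  \<open>\<lambda>\<^sub>0 V\<^bsub>y\<^sub>0\<^esub>(y\<^sup>*) + (\<Sum>k=1..<K. \<lambda>\<^sub>k V\<^bsub>y\<^sub>k\<^esub>(y\<^sup>*\<^sub>k))\<close>. With doubling weights
  \<open>\<lambda>\<^sub>k \<le> 2 \<Lambda>\<^sub>k\<close> for \<open>k \<ge> 1\<close>, so the errors \<open>\<epsilon>\<^sub>k\<close>, which decay like \<open>1 / 1.5 ^ k\<close>, contribute
  at most \<open>\<epsilon> / 2\<close> in expectation, and the initial term contributes \<open>\<epsilon> / 4\<close>. At the same time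
  \<open>\<epsilon>\<^sub>K / \<Lambda>\<^sub>K\<close> decays like \<open>1 / 3 ^ K\<close>, faster than the claimed \<open>1 / 1.5 ^ (2 * K)\<close>.

  What remains is measurability of \<open>u\<close>: the maximizer of \<open>\<phi> - \<Lambda>\<^sub>K V\<^bsub>q\<^esub>\<close> depends on \<open>q\<close> only through
  the gradient of \<open>r\<close> at \<open>q\<close>, and it is a Lipschitz function of this gradient by strong concavity.
\<close>

section \<open>Norms on a Euclidean space\<close>

lemma is_norm_le_norm:
  fixes N :: "'b::euclidean_space \<Rightarrow> real"
  assumes "is_norm N"
  shows "N v \<le> (\<Sum>b\<in>Basis. N b) * norm v"
proof -
  have add: "N (a + b) \<le> N a + N b" and scale: "N (s *\<^sub>R a) = \<bar>s\<bar> * N a" and nonneg: "0 \<le> N a"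
    and zero: "N 0 = 0" for a b s
    using assms unfolding is_norm_def by auto
  have sum_le: "N (\<Sum>b\<in>A. f b) \<le> (\<Sum>b\<in>A. N (f b))" if "finite A" for A :: "'b set" and f
    using that by (induction A) (auto simp: zero intro: order_trans[OF add])
  have "N v = N (\<Sum>b\<in>Basis. (v \<bullet> b) *\<^sub>R b)"
    by (simp add: euclidean_representation)
  also have "\<dots> \<le> (\<Sum>b\<in>Basis. \<bar>v \<bullet> b\<bar> * N b)"
    using sum_le[of Basis "\<lambda>b. (v \<bullet> b) *\<^sub>R b"] by (simp add: scale)
  also have "\<dots> \<le> (\<Sum>b\<in>Basis. norm v * N b)"
    by (intro sum_mono mult_right_mono Basis_le_norm nonneg)
  finally show ?thesis by (simp add: sum_distrib_left mult.commute)
qed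

lemma is_norm_continuous:
  fixes N :: "'b::euclidean_space \<Rightarrow> real"
  assumes "is_norm N"
  shows "continuous_on A N"
proof -
  let ?C = "\<Sum>b\<in>Basis. N b"
  have add: "N (a + b) \<le> N a + N b" for a b
    using assms unfolding is_norm_def by auto
  have "N a - N b \<le> ?C * norm (a - b)" for a b
    using add[of "a - b" b] is_norm_le_norm[OF assms, of "a - b"] by simp
  then have lip: "\<bar>N a - N b\<bar> \<le> ?C * norm (a - b)" for a b
    by (metis abs_le_iff minus_diff_eq norm_minus_commute)
  have "?C \<ge> 0"
    using assms unfolding is_norm_def by (simp add: sum_nonneg)
  with lip have "?C-lipschitz_on A N"
    by (intro lipschitz_onI) (auto simp: dist_norm)
  then show ?thesis by (rule lipschitz_on_continuous_on)
qed

text \<open>Compactness of the Euclidean sphere: a continuous function that is positive there is bounded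
  away from zero.\<close>

lemma is_norm_ge_norm:
  fixes N :: "'b::euclidean_space \<Rightarrow> real"
  assumes "is_norm N"
  obtains c where "c > 0" "\<And>v. c * norm v \<le> N v"
proof -
  have scale: "N (s *\<^sub>R a) = \<bar>s\<bar> * N a" and nonneg: "0 \<le> N a" and zero: "N a = 0 \<longleftrightarrow> a = 0" for a s
    using assms unfolding is_norm_def by auto
  obtain z where z: "z \<in> sphere 0 1" "\<And>v. v \<in> sphere 0 1 \<Longrightarrow> N z \<le> N v"
    using continuous_attains_inf[OF compact_sphere _ is_norm_continuous[OF assms], of 0 1] by auto
  have "N z > 0" using z(1) nonneg[of z] zero[of z] by (cases "z = 0") auto
  moreover have "N z * norm v \<le> N v" for v
  proof (cases "v = 0")
    case False
    then have "N z \<le> N ((1 / norm v) *\<^sub>R v)" by (intro z(2)) auto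
    with False show ?thesis by (simp add: scale field_simps)
  qed (use zero[of 0] in simp)
  ultimately show thesis using that by blast
qed

section \<open>Strongly convex functions\<close>

lemma strongly_convex_on_subset:
  "strongly_convex_on N S m f \<Longrightarrow> T \<subseteq> S \<Longrightarrow> strongly_convex_on N T m f"
  unfolding strongly_convex_on_def by blast

lemma strongly_convex_onD:
  assumes "strongly_convex_on N S m f" "a \<in> S" "b \<in> S" "0 \<le> t" "t \<le> 1"
  shows "f ((1 - t) *\<^sub>R a + t *\<^sub>R b) \<le> (1 - t) * f a + t * f b - m / 2 * t * (1 - t) * (N (a - b))\<^sup>2"
  using assms unfolding strongly_convex_on_def by auto

lemma strongly_convex_on_convex_add:
  assumes "strongly_convex_on N S m f" "convex_on S g" "0 \<le> a"
  shows "strongly_convex_on N S (a * m) (\<lambda>v. g v + a * f v)"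
  unfolding strongly_convex_on_def
proof (intro ballI)
  fix v w t assume vwt: "v \<in> S" "w \<in> S" "t \<in> {0..1::real}"
  let ?p = "(1 - t) *\<^sub>R v + t *\<^sub>R w"
  have "g ?p \<le> (1 - t) * g v + t * g w"
    using convex_onD[OF assms(2)] vwt by auto
  moreover have "a * f ?p \<le> a * ((1 - t) * f v + t * f w - m / 2 * t * (1 - t) * (N (v - w))\<^sup>2)"
    using strongly_convex_onD[OF assms(1)] vwt assms(3) by (intro mult_left_mono) auto
  ultimately show "g ?p + a * f ?p
      \<le> (1 - t) * (g v + a * f v) + t * (g w + a * f w) - a * m / 2 * t * (1 - t) * (N (v - w))\<^sup>2"
    by (simp add: algebra_simps)
qed

text \<open>Passing to the Euclidean norm costs a constant in the modulus; this suffices wherever only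
  existence, convergence or continuity is at stake.\<close>

lemma strongly_convex_on_weaker_norm:
  assumes "strongly_convex_on N S m f" "0 \<le> m" "0 \<le> c" "\<And>v. c * norm v \<le> N v"
  shows "strongly_convex_on norm S (m * c\<^sup>2) f"
  unfolding strongly_convex_on_def
proof (intro ballI)
  fix v w t assume vwt: "v \<in> S" "w \<in> S" "t \<in> {0..1::real}"
  have "(c * norm (v - w))\<^sup>2 \<le> (N (v - w))\<^sup>2"
    using assms(3,4) by (intro power_mono) auto
  then have "m / 2 * t * (1 - t) * (c * norm (v - w))\<^sup>2 \<le> m / 2 * t * (1 - t) * (N (v - w))\<^sup>2"
    using vwt assms(2) by (intro mult_left_mono) auto
  moreover have "m / 2 * t * (1 - t) * (c * norm (v - w))\<^sup>2
      = m * c\<^sup>2 / 2 * t * (1 - t) * (norm (v - w))\<^sup>2"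
    by (simp add: power_mult_distrib)
  ultimately show "f ((1 - t) *\<^sub>R v + t *\<^sub>R w)
      \<le> (1 - t) * f v + t * f w - m * c\<^sup>2 / 2 * t * (1 - t) * (norm (v - w))\<^sup>2"
    using strongly_convex_onD[OF assms(1) vwt(1,2), of t] vwt(3)
    unfolding atLeastAtMost_iff by linarith
qed

lemma le_if_le_add_small_multiple:
  fixes a b c :: real
  assumes "\<And>t. 0 < t \<Longrightarrow> t < 1 \<Longrightarrow> a \<le> b + t * c"
  shows "a \<le> b"
proof (rule tendsto_lowerbound)
  show "((\<lambda>t. b + t * c) \<longlongrightarrow> b) (at_right 0)"
    by (auto intro!: tendsto_eq_intros)
  show "eventually (\<lambda>t. a \<le> b + t * c) (at_right 0)"
    using assms by (auto simp: eventually_at_right_field intro!: exI[of _ 1])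
qed simp

text \<open>Compare the minimizer with a point of the segment to \<open>v\<close> and let that point tend to the
  minimizer: convexity alone gives nothing, and the quadratic term is what remains after division
  by the step length.\<close>

lemma strongly_convex_on_growth:
  assumes sc: "strongly_convex_on N S m f" and "convex S" "p \<in> S" "v \<in> S"
    and min: "\<And>w. w \<in> S \<Longrightarrow> f p \<le> f w"
  shows "f p + m / 2 * (N (p - v))\<^sup>2 \<le> f v"
proof (rule le_if_le_add_small_multiple[where c = "m / 2 * (N (p - v))\<^sup>2"])
  fix t :: real assume t: "0 < t" "t < 1"
  define D where "D = m / 2 * (N (p - v))\<^sup>2"
  have "f p \<le> f ((1 - t) *\<^sub>R p + t *\<^sub>R v)"
    using t assms by (intro min convexD) auto
  also have "\<dots> \<le> (1 - t) * f p + t * f v - t * (1 - t) * D"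
    using strongly_convex_onD[OF sc \<open>p \<in> S\<close> \<open>v \<in> S\<close>, of t] t by (simp add: D_def algebra_simps)
  finally have "t * (f p + D) \<le> t * (f v + t * D)"
    by (simp add: algebra_simps)
  with t show "f p + m / 2 * (N (p - v))\<^sup>2 \<le> f v + t * (m / 2 * (N (p - v))\<^sup>2)"
    by (simp add: D_def)
qed

text \<open>At distance \<open>R > 1\<close> from a base point \<open>p\<close>, the point of the segment at distance \<open>1\<close> from \<open>p\<close>
  lies in a compact set on which \<open>f\<close> is bounded below. Strong convexity along the segment forces the
  value at the far end to grow at least linearly in \<open>R\<close>.\<close>

lemma strongly_convex_on_bounded_sublevel:
  fixes f :: "'b::euclidean_space \<Rightarrow> real"
  assumes sc: "strongly_convex_on norm S m f" and "0 < m"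
    and S: "closed S" "convex S" and cont: "continuous_on S f"
  shows "bounded {v \<in> S. f v \<le> c}"
proof (cases "S = {}")
  case False
  then obtain p where p: "p \<in> S" by auto
  have "compact (S \<inter> cball p 1)" "S \<inter> cball p 1 \<noteq> {}" "continuous_on (S \<inter> cball p 1) f"
    using S p cont by (auto intro: compact_cball closed_Int_compact continuous_on_subset)
  from continuous_attains_inf[OF this]
  obtain z where "\<forall>w\<in>S \<inter> cball p 1. f z \<le> f w" by blast
  then have z: "\<And>w. w \<in> S \<Longrightarrow> norm (w - p) \<le> 1 \<Longrightarrow> f z \<le> f w"
    by (auto simp: dist_norm norm_minus_commute Ball_def)
  define A where "A = \<bar>f p\<bar> + \<bar>c\<bar> + \<bar>f z\<bar>"
  have "norm (v - p) \<le> 1 + 2 / m * A" if v: "v \<in> S" "f v \<le> c" for v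
  proof (cases "norm (v - p) \<le> 1")
    case True
    moreover have "0 \<le> 2 / m * A" using \<open>0 < m\<close> by (simp add: A_def)
    ultimately show ?thesis by linarith
  next
    case False
    \<comment> \<open>Scaling by \<open>t = 1 / R\<close> puts the intermediate point on the unit sphere around \<open>p\<close>.\<close>
    define R where "R = norm (v - p)"
    define t where "t = 1 / R"
    have R: "R > 1" using False by (simp add: R_def)
    then have t: "0 < t" "t < 1" "t * R = 1" by (auto simp: t_def)
    let ?w = "(1 - t) *\<^sub>R p + t *\<^sub>R v"
    have "?w - p = t *\<^sub>R (v - p)" by (simp add: algebra_simps)
    then have "norm (?w - p) = 1" using t by (simp add: R_def)
    then have "f z \<le> f ?w"
      using t p v S by (intro z convexD) auto
    also have "\<dots> \<le> (1 - t) * f p + t * f v - m / 2 * t * (1 - t) * R\<^sup>2"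
      using strongly_convex_onD[OF sc p v(1), of t] t by (simp add: R_def norm_minus_commute)
    also have "m / 2 * t * (1 - t) * R\<^sup>2 = m / 2 * ((t * R) * (R - t * R))"
      by algebra
    finally have "m / 2 * (R - 1) \<le> (1 - t) * f p + t * f v - f z"
      using t(3) by simp
    moreover have "(1 - t) * f p \<le> \<bar>f p\<bar>"
    proof -
      have "(1 - t) * f p \<le> (1 - t) * \<bar>f p\<bar>" using t by (intro mult_left_mono) auto
      also have "\<dots> \<le> 1 * \<bar>f p\<bar>" using t by (intro mult_right_mono) auto
      finally show ?thesis by simp
    qed
    moreover have "t * f v \<le> \<bar>c\<bar>"
    proof -
      have "t * f v \<le> t * \<bar>c\<bar>" using t v by (intro mult_left_mono) auto
      also have "\<dots> \<le> 1 * \<bar>c\<bar>" using t by (intro mult_right_mono) auto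
      finally show ?thesis by simp
    qed
    ultimately have "m / 2 * (R - 1) \<le> A" unfolding A_def by linarith
    then show ?thesis using \<open>0 < m\<close> by (simp add: R_def[symmetric] field_simps)
  qed
  then have "{v \<in> S. f v \<le> c} \<subseteq> cball p (1 + 2 / m * A)"
    by (auto simp: dist_norm norm_minus_commute)
  then show ?thesis using bounded_cball bounded_subset by blast
qed simp

lemma continuous_attains_inf_bounded_sublevel:
  fixes f :: "'b::euclidean_space \<Rightarrow> real"
  assumes "closed S" "S \<noteq> {}" "continuous_on S f" "\<And>c. bounded {v \<in> S. f v \<le> c}"
  obtains p where "p \<in> S" "\<And>v. v \<in> S \<Longrightarrow> f p \<le> f v"
proof -
  obtain s where s: "s \<in> S" using assms by auto
  let ?L = "{v \<in> S. f v \<le> f s}"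
  have "?L = S \<inter> f -` {..f s}" by auto
  then have "closed ?L"
    using continuous_closed_preimage[OF assms(3,1) closed_atMost[of "f s"]] by simp
  then have "compact ?L" using assms(4) by (simp add: compact_eq_bounded_closed)
  moreover have "?L \<noteq> {}" using s by auto
  moreover have "continuous_on ?L f" using assms(3) by (rule continuous_on_subset) auto
  ultimately have "\<exists>p\<in>?L. \<forall>v\<in>?L. f p \<le> f v"
    by (rule continuous_attains_inf)
  then obtain p where p: "p \<in> ?L" "\<forall>v\<in>?L. f p \<le> f v" ..
  have "f p \<le> f v" if "v \<in> S" for v
    using p that by (cases "f v \<le> f s") auto
  with p(1) show thesis using that by blast
qed

lemma concave_on_UNIV_continuous:
  fixes \<phi> :: "'b::euclidean_space \<Rightarrow> real"
  assumes "concave_on UNIV \<phi>"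
  shows "continuous_on A \<phi>"
proof -
  have "continuous_on UNIV (\<lambda>v. - (- \<phi> v))"
    using assms unfolding concave_on_def by (intro continuous_on_minus convex_on_continuous) auto
  then show ?thesis by (auto intro: continuous_on_subset)
qed

section \<open>A minimax inequality\<close>

text \<open>The minimizer \<open>x0\<close> of the function \<open>\<lambda>x. max (h x)\<close> and the best response \<open>b x0\<close> form a
  saddle point. Move \<open>x0\<close> towards \<open>x\<close> by a fraction \<open>t\<close>, and let \<open>y t\<close> be the best response there.
  Convexity in the first argument gives \<open>h x0 (b x0) \<le> (1 - t) * h x0 (y t) + t * h x (y t)\<close>, hence
  \<open>h x0 (b x0) \<le> h x (y t)\<close>, and it remains to see that \<open>y t\<close> tends to \<open>b x0\<close> as \<open>t\<close> tends to \<open>0\<close>.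
  The same inequality shows that \<open>y t\<close> is a nearly optimal response to \<open>x0\<close>, so strong concavity
  bounds its distance to \<open>b x0\<close>.\<close>

lemma minimax_at_minimizer:
  fixes h :: "'a::real_vector \<Rightarrow> 'b::euclidean_space \<Rightarrow> real"
  assumes X: "convex X" "x0 \<in> X" and Y: "convex Y"
    and conv: "\<And>v. v \<in> Y \<Longrightarrow> convex_on X (\<lambda>x. h x v)"
    and m: "0 < m" "\<And>x. x \<in> X \<Longrightarrow> strongly_convex_on norm Y m (\<lambda>v. - h x v)"
    and cont: "\<And>x. x \<in> X \<Longrightarrow> continuous_on Y (h x)"
    and best: "\<And>x. x \<in> X \<Longrightarrow> b x \<in> Y" "\<And>x v. x \<in> X \<Longrightarrow> v \<in> Y \<Longrightarrow> h x v \<le> h x (b x)"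
    and min: "\<And>x. x \<in> X \<Longrightarrow> h x0 (b x0) \<le> h x (b x)"
    and x: "x \<in> X"
  shows "h x0 (b x0) \<le> h x (b x0)"
proof -
  let ?f = "\<lambda>x. h x (b x)"
  define y where "y t = b ((1 - t) *\<^sub>R x0 + t *\<^sub>R x)" for t :: real
  define C where "C = ?f x - ?f x0"
  have yY: "y t \<in> Y" and mix: "?f x0 \<le> (1 - t) * h x0 (y t) + t * h x (y t)"
    if t: "0 < t" "t < 1" for t
  proof -
    have xt: "(1 - t) *\<^sub>R x0 + t *\<^sub>R x \<in> X" using t x X by (intro convexD) auto
    then show "y t \<in> Y" using best(1) by (simp add: y_def)
    then show "?f x0 \<le> (1 - t) * h x0 (y t) + t * h x (y t)"
      using min[OF xt] convex_onD[OF conv, of "y t" t x0 x] t x X by (simp add: y_def)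
  qed
  have growth: "m / 2 * (norm (y t - b x0))\<^sup>2 \<le> ?f x0 - h x0 (y t)" if "0 < t" "t < 1" for t
    using strongly_convex_on_growth[OF m(2)[OF X(2)] Y best(1)[OF X(2)] yY[OF that]] best(2)[OF X(2)]
    by (simp add: norm_minus_commute)
  have lower: "?f x0 \<le> h x (y t)" if t: "0 < t" "t < 1" for t
  proof -
    have "(1 - t) * h x0 (y t) \<le> (1 - t) * ?f x0"
      using t best(2)[OF X(2) yY[OF t]] by (intro mult_left_mono) auto
    then have "t * ?f x0 \<le> t * h x (y t)"
      using mix[OF t] by (simp add: algebra_simps)
    with t show ?thesis by simp
  qed
  \<comment> \<open>\<open>h x0 (y t)\<close> falls short of its maximum by \<open>O(t)\<close>, because \<open>x\<close> enters the mixture with weight \<open>t\<close>.\<close>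
  have rate: "(norm (y t - b x0))\<^sup>2 \<le> t / (1 - t) * (2 * C / m)" if t: "0 < t" "t < 1" for t
  proof -
    have "(1 - t) * (m / 2 * (norm (y t - b x0))\<^sup>2) \<le> (1 - t) * (?f x0 - h x0 (y t))"
      using growth[OF t] t by (intro mult_left_mono) auto
    also have "\<dots> \<le> t * (h x (y t) - ?f x0)"
      using mix[OF t] by (simp add: algebra_simps)
    also have "\<dots> \<le> t * C"
      using best(2)[OF x yY[OF t]] t by (intro mult_left_mono) (auto simp: C_def)
    finally show ?thesis using t m(1) by (simp add: field_simps)
  qed
  have "((\<lambda>t::real. t / (1 - t) * (2 * C / m)) \<longlongrightarrow> 0) (at_right 0)"
    using m(1) by (auto intro!: tendsto_eq_intros)
  then have "((\<lambda>t. (norm (y t - b x0))\<^sup>2) \<longlongrightarrow> 0) (at_right 0)"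
    by (rule tendsto_sandwich[rotated 3, where f = "\<lambda>_. 0"])
       (use rate in \<open>auto simp: eventually_at_right_field intro!: exI[of _ 1]\<close>)
  then have "((\<lambda>t. sqrt ((norm (y t - b x0))\<^sup>2)) \<longlongrightarrow> sqrt 0) (at_right 0)"
    by (rule tendsto_real_sqrt)
  then have "(y \<longlongrightarrow> b x0) (at_right 0)"
    by (simp add: tendsto_norm_zero_iff LIM_zero_iff)
  moreover have "eventually (\<lambda>t. y t \<in> Y) (at_right 0)"
    using yY by (auto simp: eventually_at_right_field intro!: exI[of _ 1])
  ultimately have "((\<lambda>t. h x (y t)) \<longlongrightarrow> h x (b x0)) (at_right 0)"
    using continuous_on_tendsto_compose[OF cont[OF x]] best(1)[OF X(2)] by blast
  then show ?thesis
    by (rule tendsto_lowerbound)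
       (use lower in \<open>auto simp: eventually_at_right_field intro!: exI[of _ 1]\<close>)
qed

section \<open>Gradients\<close>

lemma gradient_gderiv:
  assumes "f differentiable (at u)"
  shows "GDERIV f u :> gradient f u"
proof -
  obtain f' where f': "(f has_derivative f') (at u)"
    using assms by (auto simp: differentiable_def)
  interpret linear f' using f' by (rule has_derivative_linear)
  have "f' h = h \<bullet> (\<Sum>b\<in>Basis. f' b *\<^sub>R b)" for h
  proof -
    have "f' h = f' (\<Sum>b\<in>Basis. (h \<bullet> b) *\<^sub>R b)" by (simp add: euclidean_representation)
    also have "\<dots> = h \<bullet> (\<Sum>b\<in>Basis. f' b *\<^sub>R b)"
      by (simp add: sum scale inner_sum_right mult.commute)
    finally show ?thesis .
  qed
  then have "f' = (\<lambda>h. h \<bullet> (\<Sum>b\<in>Basis. f' b *\<^sub>R b))" by (rule ext)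
  with f' have "GDERIV f u :> (\<Sum>b\<in>Basis. f' b *\<^sub>R b)" unfolding gderiv_def by (rule has_derivative_subst)
  moreover have "a = b" if "GDERIV f u :> a" "GDERIV f u :> b" for a b
  proof -
    have "(\<lambda>h. h \<bullet> a) = (\<lambda>h. h \<bullet> b)"
      using that unfolding gderiv_def by (rule has_derivative_unique)
    then have "(a - b) \<bullet> a = (a - b) \<bullet> b" by (rule fun_cong)
    then show ?thesis by (metis inner_diff_right inner_eq_zero_iff right_minus_eq)
  qed
  ultimately have "\<exists>!g. GDERIV f u :> g" by blast
  then show ?thesis unfolding gradient_def by (rule theI')
qed

text \<open>The one-sided limit is the form in which the gradient enters all optimality conditions below,
  since the points compared there lie on a segment inside a convex set.\<close>

lemma gradient_directional_limit:
  assumes "f differentiable (at u)"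
  shows "((\<lambda>t. (f (u + t *\<^sub>R d) - f u) / t) \<longlongrightarrow> gradient f u \<bullet> d) (at_right 0)"
proof -
  have "((\<lambda>t. u + t *\<^sub>R d) has_derivative (\<lambda>t. t *\<^sub>R d)) (at 0)"
    by (auto intro!: derivative_eq_intros)
  moreover have "(f has_derivative (\<lambda>h. h \<bullet> gradient f u)) (at (u + 0 *\<^sub>R d))"
    using gradient_gderiv[OF assms] by (simp add: gderiv_def)
  ultimately have "((\<lambda>t. f (u + t *\<^sub>R d)) has_derivative (\<lambda>t. (t *\<^sub>R d) \<bullet> gradient f u)) (at 0)"
    by (rule has_derivative_compose)
  moreover have "(\<lambda>t. (t *\<^sub>R d) \<bullet> gradient f u) = (*) (gradient f u \<bullet> d)"
    by (auto simp: inner_commute mult.commute)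
  ultimately have "((\<lambda>t. f (u + t *\<^sub>R d)) has_field_derivative (gradient f u \<bullet> d)) (at 0)"
    by (simp add: has_field_derivative_def)
  then have "((\<lambda>t. (f (u + t *\<^sub>R d) - f u) / t) \<longlongrightarrow> gradient f u \<bullet> d) (at 0)"
    by (simp add: DERIV_def)
  then show ?thesis by (rule tendsto_mono[rotated]) (simp add: at_le)
qed

section \<open>The distance-generating function and its Bregman divergence\<close>

context dgf_setup
begin

lemma segment_in_interior:
  assumes "b \<in> P" "z \<in> interior P" "0 < t" "t \<le> 1"
  shows "(1 - t) *\<^sub>R b + t *\<^sub>R z \<in> interior P"
proof -
  have "(1 - t) *\<^sub>R b + t *\<^sub>R z = b - t *\<^sub>R (b - z)" by (simp add: algebra_simps)
  then show ?thesis using mem_interior_convex_shrink[OF convex_P assms(2,1,3,4)] by simp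
qed

lemma dgf_segment_limit:
  assumes "b \<in> P" "z \<in> P"
  shows "((\<lambda>s. r ((1 - s) *\<^sub>R b + s *\<^sub>R z)) \<longlongrightarrow> r b) (at_right 0)"
proof (rule continuous_on_tendsto_compose[OF continuous_r _ \<open>b \<in> P\<close>])
  show "((\<lambda>s. (1 - s) *\<^sub>R b + s *\<^sub>R z) \<longlongrightarrow> b) (at_right 0)"
    by (auto intro!: tendsto_eq_intros)
  show "\<forall>\<^sub>F s in at_right 0. (1 - s) *\<^sub>R b + s *\<^sub>R z \<in> P"
    using assms convex_P by (auto simp: eventually_at_right_field intro!: exI[of _ 1] convexD)
qed

text \<open>Strong convexity is assumed only on the interior part of \<open>U\<close>. Shrinking \<open>U\<close> slightly towards
  a point \<open>z\<close> of this part moves all of \<open>U\<close> into it, and the inequality survives the limit because \<open>r\<close> is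
  continuous on \<open>P\<close>.\<close>

lemma strongly_convex_on_U: "strongly_convex_on N U \<mu> r"
  unfolding strongly_convex_on_def
proof (intro ballI)
  fix a b t assume ab: "a \<in> U" "b \<in> U" and t: "t \<in> {0..1::real}"
  obtain z where z: "z \<in> U" "z \<in> interior P" using U_int_P by auto
  then have zP: "z \<in> P" and abP: "a \<in> P" "b \<in> P" using U_sub_P ab by auto
  let ?c = "(1 - t) *\<^sub>R a + t *\<^sub>R b"
  let ?sh = "\<lambda>s v. (1 - s) *\<^sub>R v + s *\<^sub>R z"
  have cU: "?c \<in> U" using convex_U ab t by (auto intro!: convexD)
  then have cP: "?c \<in> P" using U_sub_P by auto
  have approx: "r (?sh s ?c) \<le> (1 - t) * r (?sh s a) + t * r (?sh s b)
      - \<mu> / 2 * t * (1 - t) * ((1 - s) * N (a - b))\<^sup>2" if s: "0 < s" "s < 1" for s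
  proof -
    have in_int: "?sh s v \<in> U \<inter> interior P" if "v \<in> U" for v
      using that s z U_sub_P convex_U by (auto intro!: convexD segment_in_interior)
    have eq: "(1 - t) *\<^sub>R ?sh s a + t *\<^sub>R ?sh s b = ?sh s ?c"
      by (simp add: algebra_simps)
    have "?sh s a - ?sh s b = (1 - s) *\<^sub>R (a - b)" by (simp add: algebra_simps)
    then have "N (?sh s a - ?sh s b) = (1 - s) * N (a - b)"
      using norm_N s unfolding is_norm_def by simp
    with strongly_convex_onD[OF strongly_convex_r in_int in_int, OF ab, of t] t eq
    show ?thesis by simp
  qed
  show "r ?c \<le> (1 - t) * r a + t * r b - \<mu> / 2 * t * (1 - t) * (N (a - b))\<^sup>2"
  proof (rule tendsto_le)
    show "((\<lambda>s. r (?sh s ?c)) \<longlongrightarrow> r ?c) (at_right 0)"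
      by (rule dgf_segment_limit[OF cP zP])
    show "((\<lambda>s. (1 - t) * r (?sh s a) + t * r (?sh s b)
        - \<mu> / 2 * t * (1 - t) * ((1 - s) * N (a - b))\<^sup>2)
      \<longlongrightarrow> (1 - t) * r a + t * r b - \<mu> / 2 * t * (1 - t) * (N (a - b))\<^sup>2) (at_right 0)"
      by (auto intro!: tendsto_eq_intros dgf_segment_limit abP zP)
    show "\<forall>\<^sub>F s in at_right 0. r (?sh s ?c) \<le> (1 - t) * r (?sh s a) + t * r (?sh s b)
        - \<mu> / 2 * t * (1 - t) * ((1 - s) * N (a - b))\<^sup>2"
      using approx unfolding eventually_at_right_field by (intro exI[of _ 1]) auto
  qed simp
qed

text \<open>Common core of \<open>bregman_nonneg\<close> (\<open>D = 0\<close>) and \<open>bregman_ge_norm\<close>: a convexity inequality along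
  one segment with quadratic slack \<open>D\<close> becomes, in the limit of small \<open>t\<close>, the gradient inequality
  with slack \<open>D\<close>.\<close>

lemma bregman_lower_bound:
  assumes u: "u \<in> interior P"
    and D: "\<And>t. 0 < t \<Longrightarrow> t < 1 \<Longrightarrow>
      r ((1 - t) *\<^sub>R u + t *\<^sub>R v) \<le> (1 - t) * r u + t * r v - t * (1 - t) * D"
  shows "D \<le> bregman r u v"
proof -
  have "gradient r u \<bullet> (v - u) \<le> r v - r u - D"
  proof (rule tendsto_le)
    show "((\<lambda>t. (r (u + t *\<^sub>R (v - u)) - r u) / t) \<longlongrightarrow> gradient r u \<bullet> (v - u)) (at_right 0)"
      by (rule gradient_directional_limit[OF differentiable_r[OF u]])
    show "((\<lambda>t. r v - r u - (1 - t) * D) \<longlongrightarrow> r v - r u - D) (at_right 0)"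
      by (auto intro!: tendsto_eq_intros)
    have "(r (u + t *\<^sub>R (v - u)) - r u) / t \<le> r v - r u - (1 - t) * D" if t: "0 < t" "t < 1" for t
    proof -
      have "u + t *\<^sub>R (v - u) = (1 - t) *\<^sub>R u + t *\<^sub>R v" by (simp add: algebra_simps)
      then have "r (u + t *\<^sub>R (v - u)) - r u \<le> (r v - r u - (1 - t) * D) * t"
        using D[OF t] by (simp add: algebra_simps)
      with t show ?thesis by (simp add: pos_divide_le_eq)
    qed
    then show "\<forall>\<^sub>F t in at_right 0. (r (u + t *\<^sub>R (v - u)) - r u) / t \<le> r v - r u - (1 - t) * D"
      unfolding eventually_at_right_field by (intro exI[of _ 1]) auto
  qed simp
  then show ?thesis by (simp add: bregman_def)
qed

lemma bregman_nonneg: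
  assumes "u \<in> interior P" "v \<in> P"
  shows "0 \<le> bregman r u v"
  using assms convex_onD[OF convex_r, of _ u v] interior_subset[of P]
  by (intro bregman_lower_bound) auto

lemma bregman_ge_norm:
  assumes "u \<in> interior P" "u \<in> U" "v \<in> U"
  shows "\<mu> / 2 * (N (u - v))\<^sup>2 \<le> bregman r u v"
  using strongly_convex_onD[OF strongly_convex_on_U assms(2,3)]
  by (intro bregman_lower_bound assms(1)) (simp add: algebra_simps)

text \<open>Optimality condition for the sum of a convex function \<open>g\<close>, which may be nonsmooth, and a
  multiple of \<open>r\<close>: only \<open>r\<close> is linearized, while \<open>g\<close> is controlled along segments by convexity.\<close>

lemma first_order_optimality:
  assumes C: "convex C" "p \<in> C" "v \<in> C" and p: "p \<in> interior P"
    and g: "convex_on C g" and "0 \<le> a"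
    and min: "\<And>w. w \<in> C \<Longrightarrow> g p + a * r p \<le> g w + a * r w"
  shows "g p \<le> g v + a * (gradient r p \<bullet> (v - p))"
proof -
  have "g p - g v \<le> a * (gradient r p \<bullet> (v - p))"
  proof (rule tendsto_lowerbound)
    show "((\<lambda>t. a * ((r (p + t *\<^sub>R (v - p)) - r p) / t)) \<longlongrightarrow> a * (gradient r p \<bullet> (v - p))) (at_right 0)"
      by (intro tendsto_intros gradient_directional_limit differentiable_r p)
    have "g p - g v \<le> a * ((r (p + t *\<^sub>R (v - p)) - r p) / t)" if t: "0 < t" "t < 1" for t
    proof -
      let ?w = "(1 - t) *\<^sub>R p + t *\<^sub>R v"
      have w: "p + t *\<^sub>R (v - p) = ?w" by (simp add: algebra_simps)
      have "g p + a * r p \<le> g ?w + a * r ?w" using C t by (intro min convexD) auto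
      also have "g ?w \<le> (1 - t) * g p + t * g v" using convex_onD[OF g] C t by auto
      finally have "(g p - g v) * t \<le> a * (r ?w - r p)" by (simp add: algebra_simps)
      with t show ?thesis by (simp add: w pos_le_divide_eq)
    qed
    then show "\<forall>\<^sub>F t in at_right 0. g p - g v \<le> a * ((r (p + t *\<^sub>R (v - p)) - r p) / t)"
      unfolding eventually_at_right_field by (intro exI[of _ 1]) auto
  qed simp
  then show ?thesis by simp
qed

text \<open>A minimizer \<open>b\<close> on the boundary of \<open>P\<close> is impossible since \<open>r\<close> decreases infinitely
  fast when leaving \<open>b\<close> towards the interior point \<open>z\<close>, while \<open>g\<close> increases at most linearly.
  The barrier condition speaks only about the norm of the gradient \<open>G\<close> at \<open>x t = b + t (z - b)\<close>; to
  see that the slope \<open>G \<bullet> (z - b)\<close> itself tends to minus infinity, apply the gradient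
  inequality at \<open>x t\<close> to the point of a small ball around \<open>z\<close> that lies farthest in the direction
  of \<open>G\<close>. There \<open>r\<close> is bounded above, so \<open>G \<bullet> (z - b)\<close> has to compensate a multiple of \<open>norm G\<close>.\<close>

lemma minimizer_in_interior:
  assumes C: "C \<subseteq> U" "z \<in> C" and z: "z \<in> interior P" and b: "b \<in> C"
    and g: "convex_on C g" and a: "0 < a"
    and min: "\<And>w. w \<in> C \<Longrightarrow> g b + a * r b \<le> g w + a * r w"
  shows "b \<in> interior P"
proof (rule ccontr)
  assume nint: "b \<notin> interior P"
  have convC: "convex C" using g by (rule convex_on_imp_convex)
  have bU: "b \<in> U" "b \<in> P" using C(1) b U_sub_P by auto
  have bar: "filterlim (\<lambda>u. norm (gradient r u)) at_top (at b within interior P)"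
    using barrier nint bU closure_subset[of P] by (auto simp: frontier_def)
  define x where "x t = (1 - t) *\<^sub>R b + t *\<^sub>R z" for t :: real
  define G where "G t = gradient r (x t)" for t
  have x_int: "x t \<in> interior P" if "0 < t" "t < 1" for t
    using segment_in_interior[OF bU(2) z] that by (simp add: x_def)
  have "(x \<longlongrightarrow> b) (at_right 0)"
    unfolding x_def by (auto intro!: tendsto_eq_intros)
  moreover have "\<forall>\<^sub>F t in at_right 0. x t \<in> interior P \<and> x t \<noteq> b"
    unfolding eventually_at_right_field using x_int nint by (intro exI[of _ 1]) auto
  ultimately have "filterlim x (at b within interior P) (at_right 0)"
    by (simp add: filterlim_at)
  then have G_lim: "filterlim (\<lambda>t. norm (G t)) at_top (at_right 0)"
    using filterlim_compose[OF bar] by (simp add: G_def)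
  obtain \<delta> where \<delta>: "0 < \<delta>" "cball z \<delta> \<subseteq> P" using z by (auto simp: mem_interior_cball)
  have "continuous_on (cball z \<delta>) r" "cball z \<delta> \<noteq> {}"
    using \<delta> continuous_r by (auto intro: continuous_on_subset)
  then obtain s where "\<forall>w\<in>cball z \<delta>. r w \<le> r s"
    using continuous_attains_sup[OF compact_cball] by blast
  then have s: "r w \<le> r s" if "w \<in> cball z \<delta>" for w using that by blast
  have key: "norm (G t) \<le> (\<bar>g z - g b\<bar> / a + r s - r (x t)) / \<delta>" if t: "0 < t" "t < 1" for t
  proof -
    \<comment> \<open>If \<open>G t = 0\<close> then \<open>w = z\<close>, and everything below stays correct.\<close>
    define w where "w = z + (\<delta> / norm (G t)) *\<^sub>R G t"
    have wball: "w \<in> cball z \<delta>" using \<delta>(1) by (simp add: w_def dist_norm)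
    have Gw: "G t \<bullet> (w - x t) = (1 - t) * (G t \<bullet> (z - b)) + \<delta> * norm (G t)"
    proof -
      have "w - x t = (1 - t) *\<^sub>R (z - b) + (\<delta> / norm (G t)) *\<^sub>R G t"
        by (simp add: w_def x_def algebra_simps)
      then show ?thesis
        by (simp add: inner_add_right dot_square_norm power2_eq_square)
    qed
    have Gb: "G t \<bullet> (b - x t) = - t * (G t \<bullet> (z - b))"
    proof -
      have "b - x t = (- t) *\<^sub>R (z - b)" by (simp add: x_def algebra_simps)
      then show ?thesis by simp
    qed
    have "0 \<le> bregman r (x t) w" "0 \<le> bregman r (x t) b"
      using bregman_nonneg[OF x_int[OF t]] wball \<delta>(2) bU(2) by auto
    then have 1: "r (x t) + (1 - t) * (G t \<bullet> (z - b)) + \<delta> * norm (G t) \<le> r s"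
      and 2: "- t * (G t \<bullet> (z - b)) \<le> r b - r (x t)"
      using s[OF wball] Gw Gb by (simp_all add: bregman_def G_def[symmetric])
    have "g b + a * r b \<le> g (x t) + a * r (x t)"
      unfolding x_def using convC C(2) b t by (intro min convexD) auto
    also have "g (x t) \<le> (1 - t) * g b + t * g z"
      unfolding x_def using convex_onD[OF g] C(2) b t by auto
    finally have 3: "a * (r b - r (x t)) \<le> t * (g z - g b)" by (simp add: algebra_simps)
    have "t * (a * - (G t \<bullet> (z - b))) \<le> t * (g z - g b)"
      using order_trans[OF mult_left_mono[OF 2, of a] 3] a by (simp add: mult.left_commute)
    then have "a * - (G t \<bullet> (z - b)) \<le> g z - g b"
      using t(1) by (rule mult_left_le_imp_le)
    then have 4: "- (G t \<bullet> (z - b)) \<le> (g z - g b) / a"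
      using a by (simp add: pos_le_divide_eq mult.commute)
    have "(1 - t) * - (G t \<bullet> (z - b)) \<le> (1 - t) * (\<bar>g z - g b\<bar> / a)"
      using 4 t a by (intro mult_left_mono order_trans[OF 4] divide_right_mono) auto
    also have "\<dots> \<le> 1 * (\<bar>g z - g b\<bar> / a)" using t a by (intro mult_right_mono) auto
    finally have "\<delta> * norm (G t) \<le> \<bar>g z - g b\<bar> / a + r s - r (x t)" using 1 by simp
    then show ?thesis using \<delta>(1) by (simp add: pos_le_divide_eq mult.commute)
  qed
  have "((\<lambda>t. (\<bar>g z - g b\<bar> / a + r s - r (x t)) / \<delta>)
      \<longlongrightarrow> (\<bar>g z - g b\<bar> / a + r s - r b) / \<delta>) (at_right 0)"
    using dgf_segment_limit[of b z] bU z interior_subset[of P] \<delta>(1)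
    by (auto intro!: tendsto_intros simp: x_def)
  then have "\<forall>\<^sub>F t in at_right 0. (\<bar>g z - g b\<bar> / a + r s - r (x t)) / \<delta>
      < (\<bar>g z - g b\<bar> / a + r s - r b) / \<delta> + 1"
    by (rule order_tendstoD) simp
  moreover have "\<forall>\<^sub>F t in at_right 0. (\<bar>g z - g b\<bar> / a + r s - r b) / \<delta> + 1 \<le> norm (G t)"
    using G_lim by (simp add: filterlim_at_top)
  moreover have "\<forall>\<^sub>F t in at_right (0::real). 0 < t \<and> t < 1"
    unfolding eventually_at_right_field by (intro exI[of _ 1]) auto
  ultimately have "\<forall>\<^sub>F t in at_right (0::real). False"
  proof eventually_elim
    case (elim t)
    then show ?case using key[of t] by linarith
  qed
  then show False by simp
qed

text \<open>The linear part of \<open>bregman r q\<close> is absorbed into the convex function, and the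
  linearization of \<open>r\<close> at \<open>p\<close> that \<open>first_order_optimality\<close> produces is what \<open>bregman r p v\<close> measures.\<close>

lemma bregman_three_point:
  assumes C: "convex C" "p \<in> C" "v \<in> C" and p: "p \<in> interior P"
    and g: "convex_on C g" and l: "0 \<le> l"
    and min: "\<And>w. w \<in> C \<Longrightarrow> g p + l * bregman r q p \<le> g w + l * bregman r q w"
  shows "g p + l * bregman r q p + l * bregman r p v \<le> g v + l * bregman r q v"
proof -
  define g' where "g' w = g w - l * (gradient r q \<bullet> w)" for w
  have "convex_on C g'" unfolding g'_def
    using g convex_on_imp_convex[OF g]
    by (intro convex_on_diff) (auto simp: concave_on_iff inner_add_right algebra_simps)
  moreover have "g' p + l * r p \<le> g' w + l * r w" if "w \<in> C" for w
    using min[OF that] by (simp add: g'_def bregman_def inner_diff_right algebra_simps)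
  ultimately have "g' p \<le> g' v + l * (gradient r p \<bullet> (v - p))"
    using first_order_optimality[OF C p _ l] by blast
  then show ?thesis by (simp add: g'_def bregman_def inner_diff_right algebra_simps)
qed

text \<open>The gradient is a pointwise limit of difference quotients of \<open>r\<close>, and \<open>r\<close>, continuous on the
  closed set \<open>P\<close>, is Borel measurable after extension by \<open>0\<close>.\<close>

lemma gradient_measurable:
  assumes f: "f \<in> borel_measurable M" and int: "\<And>\<omega>. \<omega> \<in> space M \<Longrightarrow> f \<omega> \<in> interior P"
  shows "(\<lambda>\<omega>. gradient r (f \<omega>)) \<in> borel_measurable M"
proof -
  define R where "R u = (if u \<in> P then r u else 0)" for u
  have R: "R \<in> borel_measurable borel"
    unfolding R_def using borel_measurable_continuous_on_if[OF _ continuous_r, of "\<lambda>_. 0"] closed_P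
    by auto
  have "(\<lambda>\<omega>. gradient r (f \<omega>) \<bullet> i) \<in> borel_measurable M" if "i \<in> Basis" for i
  proof (rule borel_measurable_LIMSEQ_metric)
    let ?t = "\<lambda>n::nat. 1 / real (Suc n)"
    show "(\<lambda>\<omega>. (R (f \<omega> + ?t n *\<^sub>R i) - R (f \<omega>)) / ?t n) \<in> borel_measurable M" for n
      by (intro borel_measurable_divide borel_measurable_diff measurable_compose[OF _ R]
          borel_measurable_add f borel_measurable_const)
    fix \<omega> assume "\<omega> \<in> space M"
    then have u: "f \<omega> \<in> interior P" by (rule int)
    have t: "filterlim ?t (at_right 0) sequentially"
      unfolding at_within_def filterlim_inf filterlim_principal
      using LIMSEQ_inverse_real_of_nat by (auto simp: inverse_eq_divide)
    have "(\<lambda>n. f \<omega> + ?t n *\<^sub>R i) \<longlonglongrightarrow> f \<omega> + 0 *\<^sub>R i"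
      using LIMSEQ_inverse_real_of_nat by (intro tendsto_intros) (auto simp: inverse_eq_divide)
    then have "\<forall>\<^sub>F n in sequentially. f \<omega> + ?t n *\<^sub>R i \<in> interior P"
      using u by (intro topological_tendstoD) auto
    then have "\<forall>\<^sub>F n in sequentially. (r (f \<omega> + ?t n *\<^sub>R i) - r (f \<omega>)) / ?t n
        = (R (f \<omega> + ?t n *\<^sub>R i) - R (f \<omega>)) / ?t n"
      by eventually_elim (use u interior_subset[of P] in \<open>auto simp: R_def\<close>)
    moreover have "(\<lambda>n. (r (f \<omega> + ?t n *\<^sub>R i) - r (f \<omega>)) / ?t n) \<longlonglongrightarrow> gradient r (f \<omega>) \<bullet> i"
      by (rule filterlim_compose[OF gradient_directional_limit[OF differentiable_r[OF u]] t])
    ultimately show "(\<lambda>n. (R (f \<omega> + ?t n *\<^sub>R i) - R (f \<omega>)) / ?t n) \<longlonglongrightarrow> gradient r (f \<omega>) \<bullet> i"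
      by (rule Lim_transform_eventually[rotated])
  qed
  then show ?thesis by (subst borel_measurable_euclidean_space) blast
qed

end

section \<open>Regularized maximization\<close>

context dgf_setup
begin

text \<open>Up to a constant this is \<open>\<phi> - l * bregman r q\<close> with \<open>g = gradient r q\<close>. Taking \<open>g\<close> rather than
  \<open>q\<close> as the parameter makes the maximizer a function on the whole space, and a continuous one.\<close>

definition mirror_objective :: "('b \<Rightarrow> real) \<Rightarrow> real \<Rightarrow> 'b \<Rightarrow> 'b \<Rightarrow> real" where
  "mirror_objective \<phi> l g v = \<phi> v - l * (r v - g \<bullet> v)"

lemma minus_bregman_eq_mirror_objective:
  "\<phi> v - l * bregman r q v = mirror_objective \<phi> l (gradient r q) v + l * (r q - gradient r q \<bullet> q)"
  by (simp add: bregman_def mirror_objective_def inner_diff_right algebra_simps)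

lemma mirror_objective_strongly_concave:
  assumes "concave_on UNIV \<phi>" "Y \<subseteq> U" "convex Y" "0 \<le> l"
  shows "strongly_convex_on N Y (l * \<mu>) (\<lambda>v. - mirror_objective \<phi> l g v)"
proof -
  have "convex_on Y (\<lambda>v. - \<phi> v)"
    using assms(1,3) convex_on_subset unfolding concave_on_def by blast
  moreover have "concave_on Y (\<lambda>v. l * (g \<bullet> v))"
    using assms(3) by (auto simp: concave_on_iff inner_add_right algebra_simps)
  ultimately have "convex_on Y (\<lambda>v. - \<phi> v - l * (g \<bullet> v))"
    by (rule convex_on_diff)
  from strongly_convex_on_convex_add[OF strongly_convex_on_subset[OF strongly_convex_on_U assms(2)] this assms(4)]
  show ?thesis by (simp add: mirror_objective_def algebra_simps)
qed

lemma mirror_objective_strongly_concave_norm: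
  obtains c where "0 < c" "\<And>\<phi> Y l g. concave_on UNIV \<phi> \<Longrightarrow> Y \<subseteq> U \<Longrightarrow> convex Y \<Longrightarrow> 0 < l \<Longrightarrow>
    strongly_convex_on norm Y (l * c) (\<lambda>v. - mirror_objective \<phi> l g v)"
proof -
  obtain c where c: "c > 0" "\<And>v. c * norm v \<le> N v" using is_norm_ge_norm[OF norm_N] by blast
  have "strongly_convex_on norm Y (l * (\<mu> * c\<^sup>2)) (\<lambda>v. - mirror_objective \<phi> l g v)"
    if "concave_on UNIV \<phi>" "Y \<subseteq> U" "convex Y" "0 < l" for \<phi> Y l g
    using strongly_convex_on_weaker_norm[OF mirror_objective_strongly_concave[OF that(1-3)] _ _ c(2)]
      that(4) c(1) \<mu>_pos by (simp add: mult.assoc)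
  moreover have "\<mu> * c\<^sup>2 > 0" using c(1) \<mu>_pos by simp
  ultimately show thesis using that by blast
qed

lemma mirror_objective_continuous:
  assumes "concave_on UNIV \<phi>" "Y \<subseteq> U"
  shows "continuous_on Y (mirror_objective \<phi> l g)"
proof -
  have "continuous_on Y r" using continuous_r assms(2) U_sub_P by (auto intro: continuous_on_subset)
  then show ?thesis unfolding mirror_objective_def
    by (intro continuous_intros concave_on_UNIV_continuous[OF assms(1)])
qed

definition mirror_argmax :: "'b set \<Rightarrow> ('b \<Rightarrow> real) \<Rightarrow> real \<Rightarrow> 'b \<Rightarrow> 'b" where
  "mirror_argmax Y \<phi> l g = (SOME p. p \<in> Y \<and> (\<forall>v\<in>Y. mirror_objective \<phi> l g v \<le> mirror_objective \<phi> l g p))"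

lemma mirror_argmax:
  assumes "concave_on UNIV \<phi>" "Y \<subseteq> U" "convex Y" "closed Y" "Y \<noteq> {}" "0 < l"
  shows mirror_argmax_mem: "mirror_argmax Y \<phi> l g \<in> Y"
    and mirror_argmax_max: "v \<in> Y \<Longrightarrow> mirror_objective \<phi> l g v \<le> mirror_objective \<phi> l g (mirror_argmax Y \<phi> l g)"
proof -
  obtain c where c: "0 < c" "strongly_convex_on norm Y (l * c) (\<lambda>v. - mirror_objective \<phi> l g v)"
    using mirror_objective_strongly_concave_norm assms by metis
  have cont: "continuous_on Y (\<lambda>v. - mirror_objective \<phi> l g v)"
    by (intro continuous_on_minus mirror_objective_continuous assms)
  have "0 < l * c" using c(1) assms(6) by simp
  then obtain p where "p \<in> Y" "\<And>v. v \<in> Y \<Longrightarrow> - mirror_objective \<phi> l g p \<le> - mirror_objective \<phi> l g v"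
    using continuous_attains_inf_bounded_sublevel[OF assms(4,5) cont
        strongly_convex_on_bounded_sublevel[OF c(2) _ assms(4,3) cont]] by metis
  then have "\<exists>p. p \<in> Y \<and> (\<forall>v\<in>Y. mirror_objective \<phi> l g v \<le> mirror_objective \<phi> l g p)"
    by (intro exI[of _ p]) auto
  then have "mirror_argmax Y \<phi> l g \<in> Y \<and>
      (\<forall>v\<in>Y. mirror_objective \<phi> l g v \<le> mirror_objective \<phi> l g (mirror_argmax Y \<phi> l g))"
    unfolding mirror_argmax_def by (rule someI_ex)
  then show "mirror_argmax Y \<phi> l g \<in> Y"
    and "v \<in> Y \<Longrightarrow> mirror_objective \<phi> l g v \<le> mirror_objective \<phi> l g (mirror_argmax Y \<phi> l g)" by auto
qed

text \<open>Add the quadratic growth inequalities at the maximizers for \<open>g\<close> and for \<open>h\<close>, each tested at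
  the other maximizer: all terms cancel except \<open>l * ((g - h) \<bullet> (p g - p h))\<close>, which bounds the squared
  distance of the maximizers.\<close>

lemma mirror_argmax_continuous:
  assumes "concave_on UNIV \<phi>" "Y \<subseteq> U" "convex Y" "closed Y" "Y \<noteq> {}" "0 < l"
  shows "continuous_on UNIV (mirror_argmax Y \<phi> l)"
proof -
  obtain c where c: "0 < c" "\<And>g. strongly_convex_on norm Y (l * c) (\<lambda>v. - mirror_objective \<phi> l g v)"
    using mirror_objective_strongly_concave_norm assms by metis
  define p where "p = mirror_argmax Y \<phi> l"
  have growth: "mirror_objective \<phi> l g v + l * c / 2 * (norm (p g - v))\<^sup>2 \<le> mirror_objective \<phi> l g (p g)"
    if "v \<in> Y" for g v
  proof -
    have "- mirror_objective \<phi> l g (p g) + l * c / 2 * (norm (p g - v))\<^sup>2 \<le> - mirror_objective \<phi> l g v"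
      unfolding p_def
      by (rule strongly_convex_on_growth[OF c(2) assms(3) mirror_argmax_mem[OF assms] that])
         (simp add: mirror_argmax_max[OF assms])
    then show ?thesis by simp
  qed
  have "norm (p g - p h) \<le> 1 / c * norm (g - h)" for g h
  proof -
    define d where "d = p g - p h"
    have mem: "p g \<in> Y" "p h \<in> Y" using mirror_argmax_mem[OF assms] by (auto simp: p_def)
    have "l * c * (norm d)\<^sup>2 \<le> l * ((g - h) \<bullet> d)"
      using growth[OF mem(2), of g] growth[OF mem(1), of h]
      by (simp add: mirror_objective_def d_def norm_minus_commute inner_diff_left inner_diff_right algebra_simps)
    then have "c * (norm d)\<^sup>2 \<le> (g - h) \<bullet> d" using assms(6) by (simp add: mult.assoc)
    also have "\<dots> \<le> norm (g - h) * norm d" by (rule norm_cauchy_schwarz)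
    finally have "(c * norm d) * norm d \<le> norm (g - h) * norm d" by (simp add: power2_eq_square mult.assoc)
    then have "c * norm d \<le> norm (g - h)" by (cases "d = 0") auto
    then show ?thesis using c(1) by (simp add: d_def field_simps)
  qed
  then have "(1 / c)-lipschitz_on UNIV p"
    using c(1) by (intro lipschitz_onI) (auto simp: dist_norm)
  then show ?thesis unfolding p_def by (rule lipschitz_on_continuous_on)
qed

end

section \<open>The dual function and the regularized primal function\<close>

context dual_extraction_setup
begin

lemma psi_continuous_on_primal: "continuous_on A (\<lambda>x. \<psi> x y)"
  using convex_on_continuous[OF open_UNIV convex_psi] by (rule continuous_on_subset) auto

lemma psi_bounded_sublevel: "bounded {x \<in> X. \<psi> x y \<le> c}"
proof (cases "bounded X")
  case True
  then show ?thesis by (rule bounded_subset) auto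
next
  case False
  then obtain m where "m > 0" "strongly_convex_on norm UNIV m (\<lambda>x. \<psi> x y)"
    using X_bounded_or by blast
  then show ?thesis
    by (intro strongly_convex_on_bounded_sublevel[of _ m])
       (auto intro: strongly_convex_on_subset psi_continuous_on_primal X_set)
qed

lemma dual_fun_attained:
  obtains x where "x \<in> X" "dual_fun \<psi> X y = \<psi> x y" "\<And>x'. x' \<in> X \<Longrightarrow> dual_fun \<psi> X y \<le> \<psi> x' y"
proof -
  obtain x where x: "x \<in> X" "\<And>x'. x' \<in> X \<Longrightarrow> \<psi> x y \<le> \<psi> x' y"
    using continuous_attains_inf_bounded_sublevel[OF X_set(2,1) psi_continuous_on_primal psi_bounded_sublevel]
    by metis
  then have "dual_fun \<psi> X y = \<psi> x y"
    unfolding dual_fun_def by (intro cInf_eq_minimum) auto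
  with x that show thesis by metis
qed

lemma dual_fun_le: "x \<in> X \<Longrightarrow> dual_fun \<psi> X y \<le> \<psi> x y"
  using dual_fun_attained by metis

text \<open>The infimum is attained, so \<open>\<phi>\<close> is real-valued on the whole space and an infimum of concave
  functions. Being finite everywhere, it is continuous.\<close>

lemma dual_fun_concave: "concave_on UNIV (dual_fun \<psi> X)"
  unfolding concave_on_def
proof (rule convex_onI)
  fix t :: real and v w assume t: "0 < t" "t < 1"
  obtain x where x: "x \<in> X" "dual_fun \<psi> X ((1 - t) *\<^sub>R v + t *\<^sub>R w) = \<psi> x ((1 - t) *\<^sub>R v + t *\<^sub>R w)"
    using dual_fun_attained by blast
  have "(1 - t) * dual_fun \<psi> X v + t * dual_fun \<psi> X w \<le> (1 - t) * \<psi> x v + t * \<psi> x w"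
    using t x(1) by (intro add_mono mult_left_mono dual_fun_le) auto
  also have "\<dots> \<le> \<psi> x ((1 - t) *\<^sub>R v + t *\<^sub>R w)"
    using concave_onD[OF concave_psi] t by auto
  finally show "- dual_fun \<psi> X ((1 - t) *\<^sub>R v + t *\<^sub>R w) \<le> (1 - t) * - dual_fun \<psi> X v + t * - dual_fun \<psi> X w"
    using x(2) by simp
qed simp

lemmas mirror_argmax_Y = mirror_argmax_mem[OF _ Y_sub_U Y_set(3,2,1)]
  and mirror_argmax_Y_max = mirror_argmax_max[OF _ Y_sub_U Y_set(3,2,1)]

lemma bregman_mirror_argmax_max:
  assumes "concave_on UNIV \<phi>" "0 < l" "v \<in> Y"
  shows "\<phi> v - l * bregman r q v
    \<le> \<phi> (mirror_argmax Y \<phi> l (gradient r q)) - l * bregman r q (mirror_argmax Y \<phi> l (gradient r q))"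
  unfolding minus_bregman_eq_mirror_objective using mirror_argmax_Y_max[OF assms] by simp

lemma reg_primal_eq_value:
  assumes "p \<in> Y" "\<And>v. v \<in> Y \<Longrightarrow> \<psi> x v - l * bregman r q v \<le> \<psi> x p - l * bregman r q p"
  shows "reg_primal \<psi> Y r l q x = \<psi> x p - l * bregman r q p"
  unfolding reg_primal_def using assms by (intro cSup_eq_maximum) auto

lemma reg_primal_ge:
  assumes "0 < l" "v \<in> Y"
  shows "\<psi> x v - l * bregman r q v \<le> reg_primal \<psi> Y r l q x"
  using reg_primal_eq_value[OF mirror_argmax_Y[OF concave_psi assms(1)]
      bregman_mirror_argmax_max[OF concave_psi assms(1)]]
    bregman_mirror_argmax_max[OF concave_psi assms]
  by simp

lemma reg_primal_convex:
  assumes "0 < l"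
  shows "convex_on UNIV (reg_primal \<psi> Y r l q)"
proof (rule convex_onI)
  fix t :: real and x z :: 'a assume t: "0 < t" "t < 1"
  let ?w = "(1 - t) *\<^sub>R x + t *\<^sub>R z"
  define p where "p = mirror_argmax Y (\<psi> ?w) l (gradient r q)"
  have p: "p \<in> Y" unfolding p_def using mirror_argmax_Y[OF concave_psi assms] .
  have "reg_primal \<psi> Y r l q ?w = \<psi> ?w p - l * bregman r q p"
    using p bregman_mirror_argmax_max[OF concave_psi assms] unfolding p_def
    by (rule reg_primal_eq_value)
  also have "\<dots> \<le> (1 - t) * \<psi> x p + t * \<psi> z p - l * bregman r q p"
    using convex_onD[OF convex_psi] t by auto
  also have "\<dots> = (1 - t) * (\<psi> x p - l * bregman r q p) + t * (\<psi> z p - l * bregman r q p)"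
    by (simp add: algebra_simps)
  also have "\<dots> \<le> (1 - t) * reg_primal \<psi> Y r l q x + t * reg_primal \<psi> Y r l q z"
    using t p assms by (intro add_mono mult_left_mono reg_primal_ge) auto
  finally show "reg_primal \<psi> Y r l q ?w \<le> \<dots>" .
qed simp

lemma reg_primal_attains_inf:
  assumes "0 < l"
  obtains x where "x \<in> X" "\<And>x'. x' \<in> X \<Longrightarrow> reg_primal \<psi> Y r l q x \<le> reg_primal \<psi> Y r l q x'"
proof -
  obtain v where v: "v \<in> Y" using Y_set(1) by auto
  \<comment> \<open>A fixed competitor \<open>v\<close> transfers coercivity from \<open>\<psi>\<close> to the maximum over all of \<open>Y\<close>.\<close>
  have "{x \<in> X. reg_primal \<psi> Y r l q x \<le> c} \<subseteq> {x \<in> X. \<psi> x v \<le> c + l * bregman r q v}" for c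
  proof safe
    fix x assume "reg_primal \<psi> Y r l q x \<le> c"
    with reg_primal_ge[OF assms v, of x q] show "\<psi> x v \<le> c + l * bregman r q v" by linarith
  qed
  then have "bounded {x \<in> X. reg_primal \<psi> Y r l q x \<le> c}" for c
    by (rule bounded_subset[OF psi_bounded_sublevel])
  moreover have "continuous_on X (reg_primal \<psi> Y r l q)"
    using convex_on_continuous[OF open_UNIV reg_primal_convex[OF assms]] by (rule continuous_on_subset) auto
  ultimately show thesis
    using continuous_attains_inf_bounded_sublevel[OF X_set(2,1)] that by metis
qed

text \<open>The nontrivial direction of minimax duality between the regularized primal and dual
  functions. The saddle point supplies a single \<open>b x0\<close> that is good against every \<open>x\<close>, hence against
  the one that attains the dual function at \<open>b x0\<close>.\<close>

lemma inf_reg_primal_le_dual: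
  fixes q :: 'b
  assumes l: "0 < l"
  defines "s \<equiv> mirror_argmax Y (dual_fun \<psi> X) l (gradient r q)"
  shows "(INF x\<in>X. reg_primal \<psi> Y r l q x) \<le> dual_fun \<psi> X s - l * bregman r q s"
proof -
  let ?F = "reg_primal \<psi> Y r l q"
  define b where "b x = mirror_argmax Y (\<psi> x) l (gradient r q)" for x
  define h where "h x v = \<psi> x v - l * bregman r q v" for x v
  have b: "b x \<in> Y" "v \<in> Y \<Longrightarrow> h x v \<le> h x (b x)" for x v
    unfolding b_def h_def
    using mirror_argmax_Y[OF concave_psi l] bregman_mirror_argmax_max[OF concave_psi l] by auto
  then have F: "?F x = h x (b x)" for x
    unfolding h_def by (intro reg_primal_eq_value) auto
  obtain x0 where x0: "x0 \<in> X" "\<And>x. x \<in> X \<Longrightarrow> ?F x0 \<le> ?F x"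
    using reg_primal_attains_inf[OF l] by blast
  obtain c where c: "0 < c" "\<And>x g. strongly_convex_on norm Y (l * c) (\<lambda>v. - mirror_objective (\<psi> x) l g v)"
    using mirror_objective_strongly_concave_norm concave_psi Y_sub_U Y_set(3) l by metis
  have h_eq: "h x = (\<lambda>v. mirror_objective (\<psi> x) l (gradient r q) v + l * (r q - gradient r q \<bullet> q))" for x
    unfolding h_def by (rule ext) (rule minus_bregman_eq_mirror_objective)
  have "h x0 (b x0) \<le> h x (b x0)" if "x \<in> X" for x
  proof (rule minimax_at_minimizer[OF X_set(3) x0(1) Y_set(3)])
    show "0 < l * c" using l c(1) by simp
    show "convex_on X (\<lambda>x. h x v)" if "v \<in> Y" for v
      unfolding h_def using convex_on_subset[OF convex_psi _ X_set(3)] X_set(3)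
      by (intro convex_on_diff) (auto simp: concave_on_const)
    show "strongly_convex_on norm Y (l * c) (\<lambda>v. - h x v)" for x
      using c(2)[of x "gradient r q"] unfolding h_eq strongly_convex_on_def
      by (simp add: algebra_simps)
    show "continuous_on Y (h x)" for x
      unfolding h_eq by (intro continuous_intros mirror_objective_continuous concave_psi Y_sub_U)
    show "h x0 (b x0) \<le> h x (b x)" if "x \<in> X" for x
      using x0(2)[OF that] by (simp add: F)
  qed (use b that in auto)
  moreover obtain x where "x \<in> X" "dual_fun \<psi> X (b x0) = \<psi> x (b x0)"
    using dual_fun_attained by blast
  ultimately have "?F x0 \<le> dual_fun \<psi> X (b x0) - l * bregman r q (b x0)"
    by (metis F h_def)
  moreover have "dual_fun \<psi> X (b x0) - l * bregman r q (b x0) \<le> dual_fun \<psi> X s - l * bregman r q s"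
    unfolding s_def using bregman_mirror_argmax_max[OF dual_fun_concave l b(1)] .
  moreover have "(INF x\<in>X. ?F x) \<le> ?F x0"
    using x0 by (intro cINF_lower bdd_belowI2[of _ "?F x0"]) auto
  ultimately show ?thesis by linarith
qed

lemma drbr_interior:
  assumes "drbr_output \<psi> Y r q l x y" "0 < l"
  shows "y \<in> Y" "y \<in> interior P"
proof -
  have y: "y \<in> Y" "\<And>v. v \<in> Y \<Longrightarrow> \<psi> x v - l * bregman r q v \<le> \<psi> x y - l * bregman r q y"
    using assms(1) unfolding drbr_output_def is_arg_max_linorder by auto
  then show "y \<in> Y" by simp
  obtain z where z: "z \<in> Y" "z \<in> interior P" using Y_int_P by auto
  have "convex_on Y (\<lambda>v. - \<psi> x v)" using concave_psi Y_set(3) convex_on_subset unfolding concave_on_def by blast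
  moreover have "concave_on Y (\<lambda>v. l * (gradient r q \<bullet> v))"
    using Y_set(3) by (auto simp: concave_on_iff inner_add_right algebra_simps)
  ultimately have "convex_on Y (\<lambda>v. - \<psi> x v - l * (gradient r q \<bullet> v))"
    by (rule convex_on_diff)
  then show "y \<in> interior P"
  proof (rule minimizer_in_interior[OF Y_sub_U z y(1) _ assms(2)])
    show "- \<psi> x y - l * (gradient r q \<bullet> y) + l * r y \<le> - \<psi> x w - l * (gradient r q \<bullet> w) + l * r w"
      if "w \<in> Y" for w
      using y(2)[OF that] by (simp add: bregman_def inner_diff_right algebra_simps)
  qed
qed

text \<open>The three-point inequality for the best response \<open>y\<close> to \<open>x\<close> leaves \<open>l * bregman r y s\<close> as the
  slack between the value at \<open>y\<close>, which is the regularized primal function at \<open>x\<close>, and the value at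
  \<open>s\<close>. The latter is at least the regularized dual value of \<open>s\<close>, hence at least the infimum of the
  regularized primal function.\<close>

lemma bregman_dual_maximizer_le_gap:
  fixes q :: 'b
  assumes drbr: "drbr_output \<psi> Y r q l x y" and l: "0 < l" and x: "x \<in> X"
  defines "s \<equiv> mirror_argmax Y (dual_fun \<psi> X) l (gradient r q)"
  shows "l * bregman r y s \<le> drpo_gap \<psi> X Y r l q x"
proof -
  have y: "\<And>v. v \<in> Y \<Longrightarrow> \<psi> x v - l * bregman r q v \<le> \<psi> x y - l * bregman r q y"
    using drbr unfolding drbr_output_def is_arg_max_linorder by auto
  have s: "s \<in> Y" unfolding s_def using mirror_argmax_Y[OF dual_fun_concave l] .
  have "convex_on Y (\<lambda>v. - \<psi> x v)" using concave_psi Y_set(3) convex_on_subset unfolding concave_on_def by blast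
  moreover have "- \<psi> x y + l * bregman r q y \<le> - \<psi> x v + l * bregman r q v" if "v \<in> Y" for v
    using y[OF that] by linarith
  ultimately have "- \<psi> x y + l * bregman r q y + l * bregman r y s \<le> - \<psi> x s + l * bregman r q s"
    using l by (intro bregman_three_point[OF Y_set(3) drbr_interior(1)[OF drbr l] s drbr_interior(2)[OF drbr l]]) auto
  moreover have "reg_primal \<psi> Y r l q x = \<psi> x y - l * bregman r q y"
    using drbr_interior(1)[OF drbr l] y by (rule reg_primal_eq_value)
  moreover have "(INF x\<in>X. reg_primal \<psi> Y r l q x) \<le> dual_fun \<psi> X s - l * bregman r q s"
    unfolding s_def by (rule inf_reg_primal_le_dual[OF l])
  moreover have "dual_fun \<psi> X s \<le> \<psi> x s" by (rule dual_fun_le[OF x])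
  ultimately show ?thesis unfolding drpo_gap_def by linarith
qed

text \<open>The weighted sum of divergences is \<open>L * r\<close> minus a linear form \<open>G\<close> plus a constant. Stationarity
  of its minimizer \<open>q\<close> over \<open>U\<close> says that \<open>n = G / L - gradient r q\<close> is normal to \<open>U\<close> at \<open>q\<close>, so \<open>n\<close> is
  constant on \<open>Y\<close> and \<open>G\<close> may be replaced there by \<open>L *\<^sub>R gradient r q\<close>.\<close>

lemma mirror_step:
  fixes w :: "nat \<Rightarrow> 'b"
  assumes lam: "\<And>j. 0 < lam j" and k: "1 \<le> k"
    and q: "is_arg_min (\<lambda>p. 1 / (\<Sum>j<k. lam j) * (\<Sum>j<k. lam j * bregman r (w j) p)) (\<lambda>p. p \<in> U) q"
  shows "q \<in> interior P"
    and "\<exists>c. \<forall>v\<in>Y. (\<Sum>j<k. lam j * bregman r (w j) v) = (\<Sum>j<k. lam j) * bregman r q v + c"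
proof -
  define L where "L = (\<Sum>j<k. lam j)"
  define G where "G = (\<Sum>j<k. lam j *\<^sub>R gradient r (w j))"
  define c0 where "c0 = (\<Sum>j<k. lam j * (gradient r (w j) \<bullet> w j - r (w j)))"
  have L: "0 < L" unfolding L_def using k lam by (intro sum_pos) (auto simp: lessThan_empty_iff)
  have total: "(\<Sum>j<k. lam j * bregman r (w j) v) = L * r v - G \<bullet> v + c0" for v
    by (simp add: L_def G_def c0_def bregman_def inner_diff_right inner_sum_left sum_distrib_left
        sum.distrib sum_subtractf algebra_simps)
  have qU: "q \<in> U" and min: "- (G \<bullet> q) / L + 1 * r q \<le> - (G \<bullet> v) / L + 1 * r v" if "v \<in> U" for v
  proof -
    show "q \<in> U" using q by (simp add: is_arg_min_linorder)
    have "1 / L * (L * r q - G \<bullet> q + c0) \<le> 1 / L * (L * r v - G \<bullet> v + c0)"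
      using q that unfolding is_arg_min_linorder total L_def[symmetric] by blast
    then show "- (G \<bullet> q) / L + 1 * r q \<le> - (G \<bullet> v) / L + 1 * r v"
      using L by (simp add: field_simps)
  qed
  obtain z where z: "z \<in> U" "z \<in> interior P" using U_int_P by auto
  note qU = qU[OF z(1)]
  have lin: "convex_on U (\<lambda>v. - (G \<bullet> v) / L)"
    using convex_U by (auto simp: convex_on_def inner_add_right add_divide_distrib diff_divide_distrib algebra_simps)
  show int: "q \<in> interior P"
    by (rule minimizer_in_interior[OF subset_refl z qU lin _ min]) auto
  have first: "- (G \<bullet> q) / L \<le> - (G \<bullet> v) / L + 1 * (gradient r q \<bullet> (v - q))" if "v \<in> U" for v
    by (rule first_order_optimality[OF convex_U qU that int lin _ min]) auto
  define n where "n = G /\<^sub>R L - gradient r q"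
  have "n \<bullet> (v - q) \<le> 0" if "v \<in> U" for v
  proof -
    have "(G \<bullet> (v - q)) / L \<le> gradient r q \<bullet> (v - q)"
      using first[OF that] by (simp add: inner_diff_right[of G] diff_divide_distrib)
    then show ?thesis by (simp add: n_def inner_diff_left divide_inverse mult.commute)
  qed
  then have "n \<in> subdifferential (set_indicator U) q"
    using qU by (auto simp: subdifferential_def set_indicator_def zero_ereal_def)
  then obtain c where c: "\<And>v. v \<in> Y \<Longrightarrow> n \<bullet> v = c"
    using normal_const[of q n] qU int by auto
  have "(\<Sum>j<k. lam j * bregman r (w j) v) = L * bregman r q v + (c0 + L * (r q - gradient r q \<bullet> q) - L * c)"
    if "v \<in> Y" for v
  proof -
    have "G \<bullet> v = L * (c + gradient r q \<bullet> v)"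
      using c[OF that] L by (simp add: n_def inner_diff_left field_simps)
    then show ?thesis unfolding total by (simp add: bregman_def inner_diff_right algebra_simps)
  qed
  then show "\<exists>c. \<forall>v\<in>Y. (\<Sum>j<k. lam j * bregman r (w j) v) = (\<Sum>j<k. lam j) * bregman r q v + c"
    unfolding L_def by blast
qed

end

section \<open>Runs of the dual-extraction framework\<close>

text \<open>\<open>p (k + 1)\<close> beats \<open>p k\<close> in the objective of round \<open>k + 1\<close>, which differs from the objective of
  round \<open>k\<close> by \<open>D k\<close> alone.\<close>

lemma telescoping_maximizers:
  fixes \<phi> :: "'b \<Rightarrow> real" and D :: "nat \<Rightarrow> 'b \<Rightarrow> real"
  assumes max: "\<And>k v. 1 \<le> k \<Longrightarrow> k \<le> K \<Longrightarrow> v \<in> Y \<Longrightarrow>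
      \<phi> v - (\<Sum>j<k. D j v) \<le> \<phi> (p k) - (\<Sum>j<k. D j (p k))"
    and mem: "\<And>k. 1 \<le> k \<Longrightarrow> k \<le> K \<Longrightarrow> p k \<in> Y" "s \<in> Y" and "1 \<le> K"
  shows "\<phi> s - D 0 s - (\<Sum>k=1..<K. D k (p k)) \<le> \<phi> (p K) - (\<Sum>j<K. D j (p K))"
proof -
  have "n \<le> K \<longrightarrow> \<phi> s - D 0 s - (\<Sum>k=1..<n. D k (p k)) \<le> \<phi> (p n) - (\<Sum>j<n. D j (p n))"
    if "1 \<le> n" for n
    using that
  proof (induction n rule: dec_induct)
    case base
    show ?case using max[of 1 s] mem(2) by simp
  next
    case (step n)
    show ?case
    proof
      assume "Suc n \<le> K"
      with max[of "Suc n" "p n"] mem(1)[of n] step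
      show "\<phi> s - D 0 s - (\<Sum>k=1..<Suc n. D k (p k)) \<le> \<phi> (p (Suc n)) - (\<Sum>j<Suc n. D j (p (Suc n)))"
        by simp
    qed
  qed
  with \<open>1 \<le> K\<close> show ?thesis by simp
qed

lemma (in prob_space) expectation_le_sqrt_second_moment:
  fixes f :: "'a \<Rightarrow> real"
  assumes f: "f \<in> borel_measurable M" "integrable M (\<lambda>\<omega>. (f \<omega>)\<^sup>2)"
  shows "integrable M f" and "expectation f \<le> sqrt (expectation (\<lambda>\<omega>. (f \<omega>)\<^sup>2))"
proof -
  show int: "integrable M f" using f by (rule square_integrable_imp_integrable)
  have "0 \<le> expectation (\<lambda>\<omega>. (f \<omega>)\<^sup>2) - (expectation f)\<^sup>2"
    using variance_positive[of f] variance_eq[OF int f(2)] by simp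
  then show "expectation f \<le> sqrt (expectation (\<lambda>\<omega>. (f \<omega>)\<^sup>2))"
    by (intro real_le_rsqrt) simp
qed

text \<open>The conditional guarantee of the oracle is integrated over the past.\<close>

lemma (in prob_space) drpo_output_expected_gap:
  assumes out: "drpo_output M F \<psi> X Y r q l e x" and F: "subalgebra M F" and e: "0 \<le> e"
    and nonneg: "\<And>\<omega>. \<omega> \<in> space M \<Longrightarrow> 0 \<le> drpo_gap \<psi> X Y r l (q \<omega>) (x \<omega>)"
  shows "integrable M (\<lambda>\<omega>. drpo_gap \<psi> X Y r l (q \<omega>) (x \<omega>))"
    and "expectation (\<lambda>\<omega>. drpo_gap \<psi> X Y r l (q \<omega>) (x \<omega>)) \<le> e"
proof -
  let ?g = "\<lambda>\<omega>. drpo_gap \<psi> X Y r l (q \<omega>) (x \<omega>)"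
  interpret finite_measure_subalgebra M F
    by unfold_locales (rule F)
  have g: "?g \<in> borel_measurable M"
    and ce: "AE \<omega> in M. nn_cond_exp M F (\<lambda>\<omega>. ennreal (?g \<omega>)) \<omega> \<le> ennreal e"
    using out unfolding drpo_output_def by auto
  have "(\<integral>\<^sup>+\<omega>. ennreal (?g \<omega>) \<partial>M) = (\<integral>\<^sup>+\<omega>. nn_cond_exp M F (\<lambda>\<omega>. ennreal (?g \<omega>)) \<omega> \<partial>M)"
    using nn_cond_exp_intg[of "\<lambda>_. 1" "\<lambda>\<omega>. ennreal (?g \<omega>)"] g by simp
  also have "\<dots> \<le> (\<integral>\<^sup>+\<omega>. ennreal e \<partial>M)" using ce by (rule nn_integral_mono_AE)
  also have "\<dots> = ennreal e" by (simp add: emeasure_space_1)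
  finally have le: "(\<integral>\<^sup>+\<omega>. ennreal (?g \<omega>) \<partial>M) \<le> ennreal e" .
  show "integrable M ?g"
    using le nonneg by (intro integrableI_nonneg[OF g]) (auto intro: le_less_trans)
  show "expectation ?g \<le> e" using e le by (rule integral_real_bounded)
qed

text \<open>Weights and accuracies are kept general, so that the bounds below show how the two enter; the
  geometric schedule appears only in the last section.\<close>

locale dual_extraction =
  dual_extraction_setup \<psi> X Y U P N r \<mu> + dual_extraction_run M \<psi> X Y U r y0 K lam eps q x y
  for \<psi> :: "'a::euclidean_space \<Rightarrow> 'b::euclidean_space \<Rightarrow> real"
    and X :: "'a set" and Y :: "'b set" and U P :: "'b set"
    and N :: "'b \<Rightarrow> real" and r :: "'b \<Rightarrow> real" and \<mu> :: real
    and M :: "'w measure" and y0 :: 'b and K :: nat and lam eps :: "nat \<Rightarrow> real"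
    and q :: "nat \<Rightarrow> 'w \<Rightarrow> 'b" and x :: "nat \<Rightarrow> 'w \<Rightarrow> 'a" and y :: "nat \<Rightarrow> 'w \<Rightarrow> 'b" +
  assumes y0: "y0 \<in> Y" "y0 \<in> interior P"
    and lam_pos: "\<And>k. 0 < lam k" and eps_nonneg: "\<And>k. 0 \<le> eps k"
begin

definition Lam :: "nat \<Rightarrow> real" where "Lam k = (\<Sum>j<k. lam j)"

definition gap :: "nat \<Rightarrow> 'w \<Rightarrow> real" where
  "gap k \<omega> = drpo_gap \<psi> X Y r (Lam k) (q k \<omega>) (x k \<omega>)"

text \<open>The maximizer of the dual function minus all regularizers collected so far, by
  \<open>dual_opt_maximizes\<close>. Defining it from the gradient at \<open>q k\<close> alone makes it a measurable function of
  the run.\<close>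

definition dual_opt :: "nat \<Rightarrow> 'w \<Rightarrow> 'b" where
  "dual_opt k \<omega> = mirror_argmax Y (dual_fun \<psi> X) (Lam k) (gradient r (q k \<omega>))"

lemma Lam_pos: "k \<in> {1..K} \<Longrightarrow> 0 < Lam k"
  unfolding Lam_def using lam_pos by (intro sum_pos) (auto simp: lessThan_empty_iff)

lemma dual_opt_mem: "k \<in> {1..K} \<Longrightarrow> dual_opt k \<omega> \<in> Y"
  unfolding dual_opt_def by (intro mirror_argmax_Y dual_fun_concave Lam_pos)

lemma y_interior:
  assumes "k \<le> K" "\<omega> \<in> space M"
  shows "y k \<omega> \<in> Y" "y k \<omega> \<in> interior P"
proof -
  have "y k \<omega> \<in> Y \<and> y k \<omega> \<in> interior P"
  proof (cases "k = 0")
    case True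
    then show ?thesis using y0 y_init assms by simp
  next
    case False
    then have k: "k \<in> {1..K}" using assms by simp
    show ?thesis using drbr_interior[OF y_step[OF k assms(2)]] Lam_pos[OF k] by (simp add: Lam_def)
  qed
  then show "y k \<omega> \<in> Y" "y k \<omega> \<in> interior P" by auto
qed

lemma bregman_y_nonneg:
  assumes "k \<le> K" "\<omega> \<in> space M" "v \<in> Y"
  shows "0 \<le> bregman r (y k \<omega>) v"
  using assms y_interior Y_sub_U U_sub_P by (intro bregman_nonneg) auto

lemma bregman_dual_opt_le_gap:
  assumes k: "k \<in> {1..K}" and \<omega>: "\<omega> \<in> space M"
  shows "Lam k * bregman r (y k \<omega>) (dual_opt k \<omega>) \<le> gap k \<omega>"
proof -
  have "x k \<omega> \<in> X" using x_step[OF k] \<omega> by (simp add: drpo_output_def)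
  with y_step[OF k \<omega>] Lam_pos[OF k] show ?thesis
    unfolding gap_def dual_opt_def Lam_def by (intro bregman_dual_maximizer_le_gap)
qed

lemma gap_nonneg:
  assumes k: "k \<in> {1..K}" and \<omega>: "\<omega> \<in> space M"
  shows "0 \<le> gap k \<omega>"
proof -
  have "0 \<le> Lam k * bregman r (y k \<omega>) (dual_opt k \<omega>)"
    using k \<omega> Lam_pos[OF k] dual_opt_mem[OF k] by (intro mult_nonneg_nonneg bregman_y_nonneg) auto
  then show ?thesis using bregman_dual_opt_le_gap[OF assms] by linarith
qed

text \<open>Without this, conditional expectation given the past is \<open>0\<close> by convention and the guarantee of
  the oracle would be void.\<close>

lemma subalgebra_past_iterates:
  assumes k: "k \<in> {1..K}"
  shows "subalgebra M (past_iterates M q x y k)"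
proof -
  have q: "q j \<in> borel_measurable M" and x: "x j \<in> borel_measurable M" if "1 \<le> j" "j \<le> k" for j
    using measurable_iterates[of j] that k by auto
  have y: "y j \<in> borel_measurable M" if "j < k" for j
  proof (cases "j = 0")
    case True
    have "y 0 \<in> borel_measurable M \<longleftrightarrow> (\<lambda>_. y0) \<in> borel_measurable M"
      by (rule measurable_cong) (rule y_init)
    with True show ?thesis by simp
  qed (use measurable_iterates[of j] that k in auto)
  let ?G = "{q j -` A \<inter> space M |j A. 1 \<le> j \<and> j \<le> k \<and> A \<in> sets borel} \<union>
      {x j -` A \<inter> space M |j A. 1 \<le> j \<and> j < k \<and> A \<in> sets borel} \<union>
      {y j -` A \<inter> space M |j A. j < k \<and> A \<in> sets borel}"
  have "?G \<subseteq> sets M" using q x y by (auto intro: measurable_sets)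
  moreover from this have "?G \<subseteq> Pow (space M)" using sets.space_closed by blast
  ultimately show ?thesis
    unfolding subalgebra_def past_iterates_def
    by (simp add: space_measure_of_conv sets_measure_of sets.sigma_sets_subset)
qed

lemma gap_expectation:
  assumes k: "k \<in> {1..K}"
  shows "integrable M (gap k)" "expectation (gap k) \<le> eps k"
  using drpo_output_expected_gap[OF x_step[OF k] subalgebra_past_iterates[OF k] eps_nonneg] gap_nonneg[OF k]
  unfolding gap_def[abs_def] Lam_def by auto

lemma q_interior: "k \<in> {1..K} \<Longrightarrow> \<omega> \<in> space M \<Longrightarrow> q k \<omega> \<in> interior P"
  using mirror_step(1)[OF lam_pos _ q_step] by auto

lemma dual_opt_measurable:
  assumes k: "k \<in> {1..K}"
  shows "dual_opt k \<in> borel_measurable M"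
proof -
  have "(\<lambda>\<omega>. gradient r (q k \<omega>)) \<in> borel_measurable M"
    using measurable_iterates[OF k] q_interior[OF k] by (intro gradient_measurable) auto
  moreover have "continuous_on UNIV (mirror_argmax Y (dual_fun \<psi> X) (Lam k))"
    by (intro mirror_argmax_continuous dual_fun_concave Y_sub_U Y_set Lam_pos k)
  ultimately show ?thesis
    unfolding dual_opt_def[abs_def] by (rule borel_measurable_continuous_on[rotated])
qed

lemma dual_opt_maximizes:
  assumes k: "k \<in> {1..K}" and \<omega>: "\<omega> \<in> space M" and v: "v \<in> Y"
  shows "dual_fun \<psi> X v - (\<Sum>j<k. lam j * bregman r (y j \<omega>) v)
    \<le> dual_fun \<psi> X (dual_opt k \<omega>) - (\<Sum>j<k. lam j * bregman r (y j \<omega>) (dual_opt k \<omega>))"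
proof -
  obtain c where c: "\<And>v. v \<in> Y \<Longrightarrow>
      (\<Sum>j<k. lam j * bregman r (y j \<omega>) v) = Lam k * bregman r (q k \<omega>) v + c"
    using mirror_step(2)[OF lam_pos _ q_step[OF k \<omega>]] k unfolding Lam_def by auto
  show ?thesis
    using bregman_mirror_argmax_max[OF dual_fun_concave Lam_pos[OF k] v, of "q k \<omega>"]
    by (simp add: c v dual_opt_mem[OF k] flip: dual_opt_def)
qed

text \<open>The divergences that telescoping leaves are replaced by gaps, which, unlike the divergences,
  come with measurability and a bound on the expectation.\<close>

lemma dual_opt_suboptimality:
  assumes K: "1 \<le> K" and \<omega>: "\<omega> \<in> space M" and s: "s \<in> Y"
  shows "dual_fun \<psi> X s - lam 0 * bregman r y0 s - (\<Sum>k=1..<K. lam k / Lam k * gap k \<omega>)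
    \<le> dual_fun \<psi> X (dual_opt K \<omega>)"
proof -
  have "dual_fun \<psi> X s - lam 0 * bregman r (y 0 \<omega>) s
      - (\<Sum>k=1..<K. lam k * bregman r (y k \<omega>) (dual_opt k \<omega>))
    \<le> dual_fun \<psi> X (dual_opt K \<omega>) - (\<Sum>j<K. lam j * bregman r (y j \<omega>) (dual_opt K \<omega>))"
    using K s dual_opt_maximizes[OF _ \<omega>] dual_opt_mem
    by (intro telescoping_maximizers[where Y = Y]) auto
  moreover have "0 \<le> (\<Sum>j<K. lam j * bregman r (y j \<omega>) (dual_opt K \<omega>))"
    using K \<omega> lam_pos dual_opt_mem
    by (intro sum_nonneg mult_nonneg_nonneg bregman_y_nonneg) (auto intro: less_imp_le)
  moreover have "(\<Sum>k=1..<K. lam k * bregman r (y k \<omega>) (dual_opt k \<omega>)) \<le> (\<Sum>k=1..<K. lam k / Lam k * gap k \<omega>)"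
  proof (rule sum_mono)
    fix k assume "k \<in> {1..<K}"
    then have k: "k \<in> {1..K}" by auto
    have "lam k / Lam k * (Lam k * bregman r (y k \<omega>) (dual_opt k \<omega>)) \<le> lam k / Lam k * gap k \<omega>"
      using lam_pos[of k] Lam_pos[OF k] bregman_dual_opt_le_gap[OF k \<omega>] by (intro mult_left_mono) auto
    then show "lam k * bregman r (y k \<omega>) (dual_opt k \<omega>) \<le> lam k / Lam k * gap k \<omega>"
      using Lam_pos[OF k] by simp
  qed
  ultimately show ?thesis using y_init[OF \<omega>] by simp
qed

text \<open>The dual value of \<open>dual_opt K\<close> is sandwiched between \<open>dual_fun \<psi> X s\<close> and an integrable
  function, which gives integrability along with the bound.\<close>

lemma dual_opt_expected_suboptimality:
  assumes K: "1 \<le> K" and s: "s \<in> Y" and max: "\<And>v. v \<in> Y \<Longrightarrow> dual_fun \<psi> X v \<le> dual_fun \<psi> X s"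
  shows "integrable M (\<lambda>\<omega>. dual_fun \<psi> X (dual_opt K \<omega>))"
    and "dual_fun \<psi> X s - expectation (\<lambda>\<omega>. dual_fun \<psi> X (dual_opt K \<omega>))
      \<le> lam 0 * bregman r y0 s + (\<Sum>k=1..<K. lam k / Lam k * eps k)"
proof -
  define E where "E \<omega> = (\<Sum>k=1..<K. lam k / Lam k * gap k \<omega>)" for \<omega>
  define D where "D = lam 0 * bregman r y0 s"
  let ?f = "\<lambda>\<omega>. dual_fun \<psi> X (dual_opt K \<omega>)"
  have E: "integrable M E"
    unfolding E_def[abs_def] using gap_expectation(1)
    by (intro Bochner_Integration.integrable_sum integrable_mult_right) auto
  have lower: "dual_fun \<psi> X s - D - E \<omega> \<le> ?f \<omega>" if "\<omega> \<in> space M" for \<omega>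
    unfolding D_def E_def using dual_opt_suboptimality[OF K that s] .
  have upper: "?f \<omega> \<le> dual_fun \<psi> X s" for \<omega>
    using K dual_opt_mem by (intro max) auto
  have "?f \<in> borel_measurable M"
    using K by (intro borel_measurable_continuous_on[OF concave_on_UNIV_continuous[OF dual_fun_concave]]
        dual_opt_measurable) auto
  moreover have "integrable M (\<lambda>\<omega>. \<bar>dual_fun \<psi> X s\<bar> + \<bar>D\<bar> + \<bar>E \<omega>\<bar>)"
    using E by simp
  moreover have "AE \<omega> in M. norm (?f \<omega>) \<le> norm (\<bar>dual_fun \<psi> X s\<bar> + \<bar>D\<bar> + \<bar>E \<omega>\<bar>)"
  proof (rule AE_I2)
    fix \<omega> assume "\<omega> \<in> space M"
    with lower[OF this] upper[of \<omega>] show "norm (?f \<omega>) \<le> norm (\<bar>dual_fun \<psi> X s\<bar> + \<bar>D\<bar> + \<bar>E \<omega>\<bar>)"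
      unfolding real_norm_def by linarith
  qed
  ultimately show int: "integrable M ?f"
    using Bochner_Integration.integrable_bound by blast
  have "expectation (\<lambda>\<omega>. dual_fun \<psi> X s - D - E \<omega>) \<le> expectation ?f"
    using E int lower by (intro integral_mono) auto
  moreover have "expectation (\<lambda>\<omega>. dual_fun \<psi> X s - D - E \<omega>) = dual_fun \<psi> X s - D - expectation E"
    using E by (simp add: prob_space)
  moreover have "expectation E = (\<Sum>k=1..<K. lam k / Lam k * expectation (gap k))"
    unfolding E_def[abs_def] using gap_expectation(1)
    by (subst Bochner_Integration.integral_sum) auto
  moreover have "\<dots> \<le> (\<Sum>k=1..<K. lam k / Lam k * eps k)"
  proof (rule sum_mono)
    fix k assume "k \<in> {1..<K}"
    then have k: "k \<in> {1..K}" by auto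
    show "lam k / Lam k * expectation (gap k) \<le> lam k / Lam k * eps k"
      using lam_pos[of k] Lam_pos[OF k] gap_expectation(2)[OF k] by (intro mult_left_mono) auto
  qed
  ultimately show "dual_fun \<psi> X s - expectation ?f \<le> D + (\<Sum>k=1..<K. lam k / Lam k * eps k)"
    by linarith
qed

text \<open>Strong convexity controls the square of the distance by the gap, and the second moment
  controls the first.\<close>

lemma expected_distance_to_dual_opt:
  assumes k: "k \<in> {1..K}"
  shows "integrable M (\<lambda>\<omega>. N (y k \<omega> - dual_opt k \<omega>))"
    and "expectation (\<lambda>\<omega>. N (y k \<omega> - dual_opt k \<omega>)) \<le> sqrt (2 * eps k / (\<mu> * Lam k))"
proof -
  let ?f = "\<lambda>\<omega>. N (y k \<omega> - dual_opt k \<omega>)"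
  have L: "0 < \<mu> * Lam k" using Lam_pos[OF k] \<mu>_pos by simp
  have f: "?f \<in> borel_measurable M"
    using measurable_iterates[OF k] dual_opt_measurable[OF k]
    by (intro borel_measurable_continuous_on[OF is_norm_continuous[OF norm_N]] borel_measurable_diff) auto
  have le: "(?f \<omega>)\<^sup>2 \<le> 2 / (\<mu> * Lam k) * gap k \<omega>" if \<omega>: "\<omega> \<in> space M" for \<omega>
  proof -
    have "\<mu> / 2 * (?f \<omega>)\<^sup>2 \<le> bregman r (y k \<omega>) (dual_opt k \<omega>)"
      using k \<omega> y_interior[of k \<omega>] dual_opt_mem[OF k] Y_sub_U by (intro bregman_ge_norm) auto
    then have "Lam k * (\<mu> / 2 * (?f \<omega>)\<^sup>2) \<le> gap k \<omega>"
      using mult_left_mono[of _ _ "Lam k"] Lam_pos[OF k] bregman_dual_opt_le_gap[OF k \<omega>]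
      by (meson less_imp_le order_trans)
    then show ?thesis using L by (simp add: field_simps)
  qed
  have int_gap: "integrable M (\<lambda>\<omega>. 2 / (\<mu> * Lam k) * gap k \<omega>)"
    using gap_expectation(1)[OF k] by simp
  have f2: "integrable M (\<lambda>\<omega>. (?f \<omega>)\<^sup>2)"
  proof (rule Bochner_Integration.integrable_bound[OF int_gap])
    show "(\<lambda>\<omega>. (?f \<omega>)\<^sup>2) \<in> borel_measurable M" using f by simp
    show "AE \<omega> in M. norm ((?f \<omega>)\<^sup>2) \<le> norm (2 / (\<mu> * Lam k) * gap k \<omega>)"
    proof (rule AE_I2)
      fix \<omega> assume "\<omega> \<in> space M"
      from order_trans[OF le[OF this] abs_ge_self]
      show "norm ((?f \<omega>)\<^sup>2) \<le> norm (2 / (\<mu> * Lam k) * gap k \<omega>)" by (simp only: real_norm_def abs_power2)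
    qed
  qed
  show "integrable M ?f" using expectation_le_sqrt_second_moment(1)[OF f f2] .
  have "expectation (\<lambda>\<omega>. (?f \<omega>)\<^sup>2) \<le> expectation (\<lambda>\<omega>. 2 / (\<mu> * Lam k) * gap k \<omega>)"
    using f2 int_gap le by (intro integral_mono) auto
  also have "\<dots> = 2 / (\<mu> * Lam k) * expectation (gap k)" by simp
  also have "\<dots> \<le> 2 / (\<mu> * Lam k) * eps k"
    using L gap_expectation(2)[OF k] by (intro mult_left_mono) auto
  finally have "expectation (\<lambda>\<omega>. (?f \<omega>)\<^sup>2) \<le> 2 * eps k / (\<mu> * Lam k)" by simp
  then show "expectation ?f \<le> sqrt (2 * eps k / (\<mu> * Lam k))"
    using expectation_le_sqrt_second_moment(2)[OF f f2] by (meson order_trans real_sqrt_le_mono)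
qed

end

section \<open>The geometric schedule\<close>

lemma sum_powers_two_times: "(\<Sum>j<k. 2 ^ j * c) = (2 ^ k - 1) * (c::real)"
  by (induction k) (auto simp: algebra_simps)

lemma sum_inverse_powers_three_halves_le: "(\<Sum>k=1..<n. 1 / 1.5 ^ k) \<le> (2::real)"
proof (cases "n = 0")
  case False
  have "(\<Sum>k=1..<Suc m. 1 / 1.5 ^ k) = 2 - 2 / (1.5::real) ^ m" for m
    by (induction m) (auto simp: field_simps)
  moreover obtain m where "n = Suc m" using False not0_implies_Suc by blast
  ultimately show ?thesis by simp
qed simp

text \<open>Of the two factors \<open>1.5 ^ K\<close> in the square of the distance bound, one comes from the oracle
  accuracy and the other is absorbed by the total weight \<open>2 ^ K - 1\<close>.\<close>

lemma powers_three_halves_le: "1 \<le> k \<Longrightarrow> 1.5 ^ k \<le> 2 * (2 ^ k - 1 :: real)"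
proof (induction k rule: dec_induct)
  case (step k)
  have "(1.5::real) ^ Suc k = 1.5 * 1.5 ^ k" by simp
  also have "\<dots> \<le> 1.5 * (2 * (2 ^ k - 1))" using step.IH by (intro mult_left_mono) auto
  also have "\<dots> \<le> 2 * (2 ^ Suc k - 1)" by (simp add: algebra_simps)
  finally show ?case .
qed simp

theorem corollary6:
  fixes \<psi> :: "real ^ 'd \<Rightarrow> real ^ 'n \<Rightarrow> real"
    and X :: "(real ^ 'd) set" and Y U P :: "(real ^ 'n) set"
    and N :: "real ^ 'n \<Rightarrow> real" and r :: "real ^ 'n \<Rightarrow> real" and \<mu> :: real
    and y0 ystar :: "real ^ 'n" and B \<epsilon> :: real and K :: nat
    and M :: "'w measure"
    and q :: "nat \<Rightarrow> 'w \<Rightarrow> real ^ 'n" and x :: "nat \<Rightarrow> 'w \<Rightarrow> real ^ 'd"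
    and y :: "nat \<Rightarrow> 'w \<Rightarrow> real ^ 'n"
  assumes "dual_extraction_setup \<psi> X Y U P N r \<mu>"
    and "y0 \<in> Y \<inter> interior P"
    and "is_arg_max (dual_fun \<psi> X) (\<lambda>v. v \<in> Y) ystar"
    and "B > 0"
    and "bregman r y0 ystar \<le> B"
    and "\<epsilon> > 0"
    and "dual_extraction_run M \<psi> X Y U r y0 K
           (\<lambda>k. 2 ^ k * (\<epsilon> / (4 * B))) (\<lambda>k. \<epsilon> / (8 * 1.5 ^ k)) q x y"
  shows "\<exists>u \<in> borel_measurable M.
           (\<forall>\<omega>\<in>space M. u \<omega> \<in> Y) \<and>
           integrable M (\<lambda>\<omega>. dual_fun \<psi> X (u \<omega>)) \<and>
           dual_fun \<psi> X ystar - (\<integral>\<omega>. dual_fun \<psi> X (u \<omega>) \<partial>M) \<le> \<epsilon> \<and>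
           integrable M (\<lambda>\<omega>. N (y K \<omega> - u \<omega>)) \<and>
           (\<integral>\<omega>. N (y K \<omega> - u \<omega>) \<partial>M) \<le> 1 / 1.5 ^ K * sqrt (2 * B / \<mu>)"
proof -
  define lam where "lam k = 2 ^ k * (\<epsilon> / (4 * B))" for k :: nat
  define eps where "eps k = \<epsilon> / (8 * 1.5 ^ k)" for k :: nat
  interpret dual_extraction \<psi> X Y U P N r \<mu> M y0 K lam eps q x y
  proof (intro dual_extraction.intro dual_extraction_axioms.intro)
    show "dual_extraction_run M \<psi> X Y U r y0 K lam eps q x y"
      using assms(7) unfolding lam_def[abs_def] eps_def[abs_def] .
  qed (use assms(1,2,4,6) in \<open>auto simp: lam_def eps_def\<close>)
  have \<mu>: "0 < \<mu>" by (rule \<mu>_pos)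
  have ystar: "ystar \<in> Y" "\<And>v. v \<in> Y \<Longrightarrow> dual_fun \<psi> X v \<le> dual_fun \<psi> X ystar"
    using assms(3) by (auto simp: is_arg_max_linorder)
  show ?thesis
  proof (cases "K = 0")
    case True
    have "\<mu> / 2 * (N (y0 - ystar))\<^sup>2 \<le> B"
      using y0 ystar(1) Y_sub_U by (intro order_trans[OF bregman_ge_norm assms(5)]) auto
    then have dist: "N (y0 - ystar) \<le> sqrt (2 * B / \<mu>)"
      using \<mu> by (intro real_le_rsqrt) (simp add: field_simps)
    \<comment> \<open>No round is played, so \<open>y K\<close> is the starting point and \<open>ystar\<close> itself serves as \<open>u\<close>.\<close>
    have const: "N (y K \<omega> - ystar) = N (y0 - ystar)" if "\<omega> \<in> space M" for \<omega>
      using True y_init[OF that] by simp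
    have "integrable M (\<lambda>\<omega>. N (y K \<omega> - ystar)) \<longleftrightarrow> integrable M (\<lambda>\<omega>. N (y0 - ystar))"
      using const by (rule Bochner_Integration.integrable_cong[OF refl])
    moreover have "(\<integral>\<omega>. N (y K \<omega> - ystar) \<partial>M) = (\<integral>\<omega>. N (y0 - ystar) \<partial>M)"
      using const by (rule Bochner_Integration.integral_cong[OF refl])
    ultimately show ?thesis
      using dist ystar(1) assms(6) True
      by (intro bexI[of _ "\<lambda>_. ystar"]) (auto simp: prob_space)
  next
    case False
    then have K: "K \<in> {1..K}" "1 \<le> K" by auto
    have Lam: "Lam k = (2 ^ k - 1) * (\<epsilon> / (4 * B))" for k
      unfolding Lam_def lam_def by (rule sum_powers_two_times)
    \<comment> \<open>Doubling weights: the next weight exceeds the sum of all previous ones by a single \<open>lam 0\<close>.\<close>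
    have ratio: "lam k / Lam k \<le> 2" if "1 \<le> k" for k
    proof -
      have "(2::real) ^ k \<ge> 2 ^ 1" using that by (intro power_increasing) auto
      then show ?thesis using assms(4,6) unfolding Lam lam_def by (simp add: field_simps)
    qed
    have "(\<Sum>k=1..<K. lam k / Lam k * eps k) \<le> (\<Sum>k=1..<K. \<epsilon> / 4 * (1 / 1.5 ^ k))"
    proof (rule sum_mono)
      fix k assume "k \<in> {1..<K}"
      then have "lam k / Lam k * eps k \<le> 2 * eps k"
        using ratio eps_nonneg by (intro mult_right_mono) auto
      then show "lam k / Lam k * eps k \<le> \<epsilon> / 4 * (1 / 1.5 ^ k)" by (simp add: eps_def)
    qed
    also have "\<dots> = \<epsilon> / 4 * (\<Sum>k=1..<K. 1 / 1.5 ^ k)" by (rule sum_distrib_left[symmetric])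
    also have "\<dots> \<le> \<epsilon> / 4 * 2"
      using assms(6) by (intro mult_left_mono sum_inverse_powers_three_halves_le) auto
    finally have errors: "(\<Sum>k=1..<K. lam k / Lam k * eps k) \<le> \<epsilon> / 2" by simp
    have "lam 0 * bregman r y0 ystar \<le> lam 0 * B"
      using lam_pos[of 0] assms(5) by (intro mult_left_mono) auto
    also have "\<dots> = \<epsilon> / 4" using assms(4) by (simp add: lam_def)
    finally have init: "lam 0 * bregman r y0 ystar \<le> \<epsilon> / 4" .
    have int: "integrable M (\<lambda>\<omega>. dual_fun \<psi> X (dual_opt K \<omega>))"
      by (rule dual_opt_expected_suboptimality(1)[OF K(2) ystar(1)]) (rule ystar(2))
    have "dual_fun \<psi> X ystar - expectation (\<lambda>\<omega>. dual_fun \<psi> X (dual_opt K \<omega>))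
        \<le> lam 0 * bregman r y0 ystar + (\<Sum>k=1..<K. lam k / Lam k * eps k)"
      by (rule dual_opt_expected_suboptimality(2)[OF K(2) ystar(1)]) (rule ystar(2))
    then have subopt: "dual_fun \<psi> X ystar - expectation (\<lambda>\<omega>. dual_fun \<psi> X (dual_opt K \<omega>)) \<le> \<epsilon>"
      using init errors assms(6) by linarith
    define a where "a = (1.5::real) ^ K"
    define b where "b = (2::real) ^ K - 1"
    have ab: "0 < a" "a \<le> 2 * b" unfolding a_def b_def using powers_three_halves_le[OF K(2)] by auto
    then have "0 < b" by linarith
    have "2 * eps K / (\<mu> * Lam K) = B / (\<mu> * a * b)"
      unfolding eps_def Lam a_def[symmetric] b_def[symmetric] using assms(4,6) by (simp add: field_simps)
    also have "\<dots> \<le> 2 * B / (\<mu> * a * a)"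
      using ab \<open>0 < b\<close> \<mu> assms(4) by (simp add: field_simps)
    finally have "sqrt (2 * eps K / (\<mu> * Lam K)) \<le> sqrt (2 * B / \<mu> / a\<^sup>2)"
      by (simp add: power2_eq_square mult.assoc)
    also have "\<dots> = 1 / 1.5 ^ K * sqrt (2 * B / \<mu>)"
      using ab(1) unfolding a_def[symmetric] by (subst real_sqrt_divide) simp
    finally have "expectation (\<lambda>\<omega>. N (y K \<omega> - dual_opt K \<omega>)) \<le> 1 / 1.5 ^ K * sqrt (2 * B / \<mu>)"
      using expected_distance_to_dual_opt(2)[OF K(1)] by linarith
    then show ?thesis
      using dual_opt_measurable[OF K(1)] dual_opt_mem[OF K(1)] subopt int
        expected_distance_to_dual_opt(1)[OF K(1)]
      by blast
  qed
qed

end
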